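(* Let $F$ be a minimally unsatisfiable clause-set with deficiency $\delta(F) = c(F)-n(F) = 2$. Then any two elements of $\mathrm{sDP}(F)$ are isomorphic.
   Context: Literals are variables $v$ and complements $\overline{v}$; a clause is a finite set of literals with no complementary pair; a clause-set is a finite set of clauses; $\mathrm{var}(F)$ is the set of variables of $F$, $n(F)=|\mathrm{var}(F)|$, $c(F)=|F|$; $\mathrm{ldeg}_F(x)$ is the number of clauses of $F$ containing literal $x$. $\mathrm{DP}_v(F) := \{C \in F : v \notin \mathrm{var}(C)\} \cup \{(C \cup D)\setminus\{v,\overline{v}\} : C, D \in F,\ C \cap \overline{D} = \{v\}\}$. $\mathrm{MU}$ is the set of minimally unsatisfiable clause-sets. A variable $v$ is singular for $F$ if $\min(\mathrm{ldeg}_F(v),\mathrm{ldeg}_F(\overline{v}))=1$; $F$ is nonsingular if it has none. A singular DP-reduction step is $F\leadsto \mathrm{DP}_v(F)$ for $F\in\mathrm{MU}$ and $v$ singular for $F$. $\mathrm{sDP}(F)$ is the set of nonsingular $F'\in\mathrm{MU}$ obtainable from $F$ by zero or more singular DP-reduction steps. Clause-sets $F,G$ are isomorphic if there is a bijection on literals commuting with complementation mapping the clauses of $F$ exactly onto the clauses of $G$. *)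

theory Defs
  imports Main
begin

datatype 'v lit = Pos 'v | Neg 'v

fun comp :: "'v lit \<Rightarrow> 'v lit" where
  "comp (Pos v) = Neg v"
| "comp (Neg v) = Pos v"

fun var_lit :: "'v lit \<Rightarrow> 'v" where
  "var_lit (Pos v) = v"
| "var_lit (Neg v) = v"

type_synonym 'v clause = "'v lit set"
type_synonym 'v cls = "'v clause set"

definition is_clause :: "'v clause \<Rightarrow> bool" where
  "is_clause C \<longleftrightarrow> finite C \<and> (\<forall>x\<in>C. comp x \<notin> C)"

definition is_clauseset :: "'v cls \<Rightarrow> bool" where
  "is_clauseset F \<longleftrightarrow> finite F \<and> (\<forall>C\<in>F. is_clause C)"

definition var_clause :: "'v clause \<Rightarrow> 'v set" where
  "var_clause C = var_lit ` C"

definition var :: "'v cls \<Rightarrow> 'v set" where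
  "var F = (\<Union>C\<in>F. var_clause C)"

definition n_vars :: "'v cls \<Rightarrow> nat" where
  "n_vars F = card (var F)"

definition c_cls :: "'v cls \<Rightarrow> nat" where
  "c_cls F = card F"

definition deficiency :: "'v cls \<Rightarrow> int" where
  "deficiency F = int (c_cls F) - int (n_vars F)"

definition ldeg :: "'v cls \<Rightarrow> 'v lit \<Rightarrow> nat" where
  "ldeg F x = card {C \<in> F. x \<in> C}"

definition DP :: "'v \<Rightarrow> 'v cls \<Rightarrow> 'v cls" where
  "DP v F = {C \<in> F. v \<notin> var_clause C}
     \<union> {(C \<union> D) - {Pos v, Neg v} | C D. C \<in> F \<and> D \<in> F \<and> C \<inter> comp ` D = {Pos v}}"

definition lit_true :: "('v \<Rightarrow> bool) \<Rightarrow> 'v lit \<Rightarrow> bool" where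
  "lit_true \<phi> x = (case x of Pos v \<Rightarrow> \<phi> v | Neg v \<Rightarrow> \<not> \<phi> v)"

definition satisfiable :: "'v cls \<Rightarrow> bool" where
  "satisfiable F \<longleftrightarrow> (\<exists>\<phi>. \<forall>C\<in>F. \<exists>x\<in>C. lit_true \<phi> x)"

definition MU :: "'v cls set" where
  "MU = {F. is_clauseset F \<and> \<not> satisfiable F \<and> (\<forall>C\<in>F. satisfiable (F - {C}))}"

definition singular :: "'v cls \<Rightarrow> 'v \<Rightarrow> bool" where
  "singular F v \<longleftrightarrow> min (ldeg F (Pos v)) (ldeg F (Neg v)) = 1"

definition nonsingular :: "'v cls \<Rightarrow> bool" where
  "nonsingular F \<longleftrightarrow> (\<forall>v. \<not> singular F v)"

definition sdp_step :: "'v cls \<Rightarrow> 'v cls \<Rightarrow> bool" where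
  "sdp_step F G \<longleftrightarrow> F \<in> MU \<and> (\<exists>v. singular F v \<and> G = DP v F)"

definition sDP :: "'v cls \<Rightarrow> 'v cls set" where
  "sDP F = {F'. sdp_step\<^sup>*\<^sup>* F F' \<and> F' \<in> MU \<and> nonsingular F'}"

definition isomorphic :: "'v cls \<Rightarrow> 'v cls \<Rightarrow> bool" where
  "isomorphic F G \<longleftrightarrow> (\<exists>f :: 'v lit \<Rightarrow> 'v lit. bij f \<and> (\<forall>x. f (comp x) = comp (f x))
      \<and> (\<lambda>C. f ` C) ` F = G)"

end

theory Submission
  imports Defs
begin

text \<open>If the literal \<open>x\<close> occurs exactly once in \<open>F\<close>, in the clause \<open>C\<close>, then singular DP-reduction
  on its variable removes \<open>C\<close> and substitutes \<open>C - {x}\<close> for the complement of \<open>x\<close> in all other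
  clauses. Two such reductions commute whenever they can be performed with different clauses \<open>C\<close>.
  Hence, by induction, two reduction sequences can only diverge if all literals occurring once lie
  in one clause \<open>C\<close> and their complements occur at least twice; then every single reduction is
  already nonsingular.

  For deficiency two this forces \<open>C = {x, y}\<close>, and the two results differ by exchanging the
  complement of \<open>x\<close> with \<open>y\<close>. The reason is that in a nonsingular \<open>G \<in> MU\<close> of deficiency two
  every literal occurs exactly twice and \<open>G\<close> is saturated (no literal can be added to a clause
  without losing unsatisfiability), so that setting a literal to true stays in \<open>MU\<close>; if all clauses
  containing \<open>y\<close> contained \<open>z\<close> as well, then setting \<open>y\<close> to true would leave the complement of \<open>z\<close>
  pure. The degrees are computed by splitting a saturation of \<open>G\<close> on a variable of minimal degree
  into two clause-sets of deficiency one, which share all but two clauses each.\<close>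

section \<open>Literals and assignments\<close>

lemma comp_comp [simp]: "comp (comp x) = x"
  by (cases x) auto

lemma var_lit_comp [simp]: "var_lit (comp x) = var_lit x"
  by (cases x) auto

lemma comp_neq [simp]: "comp x \<noteq> x" "x \<noteq> comp x"
  by (cases x; simp)+

lemma comp_eq_iff [simp]: "comp x = comp y \<longleftrightarrow> x = y"
  by (metis comp_comp)

lemma var_lit_eq_iff: "var_lit x = var_lit y \<longleftrightarrow> x = y \<or> x = comp y"
  by (cases x; cases y) auto

lemma comp_eq_swap: "comp x = y \<longleftrightarrow> x = comp y"
  by (metis comp_comp)

lemma mem_comp_image: "x \<in> comp ` D \<longleftrightarrow> comp x \<in> D"
  by (metis comp_comp image_iff)

lemma lit_true_comp [simp]: "lit_true \<phi> (comp x) \<longleftrightarrow> \<not> lit_true \<phi> x"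
  by (cases x) (auto simp: lit_true_def)

text \<open>Indexed by a literal instead of a variable and a value, so that one argument covers both
  signs; \<open>make_true (comp x)\<close> makes \<open>x\<close> false.\<close>

definition make_true :: "'v lit \<Rightarrow> ('v \<Rightarrow> bool) \<Rightarrow> 'v \<Rightarrow> bool" where
  "make_true x \<phi> = \<phi>(var_lit x := (case x of Pos _ \<Rightarrow> True | Neg _ \<Rightarrow> False))"

lemma lit_true_make_true:
  "lit_true (make_true x \<phi>) y \<longleftrightarrow> y = x \<or> y \<noteq> comp x \<and> lit_true \<phi> y"
  by (cases x; cases y) (auto simp: make_true_def lit_true_def)

definition csat :: "('v \<Rightarrow> bool) \<Rightarrow> 'v clause \<Rightarrow> bool" where
  "csat \<phi> C \<longleftrightarrow> (\<exists>x\<in>C. lit_true \<phi> x)"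

lemma satisfiable_csat: "satisfiable F \<longleftrightarrow> (\<exists>\<phi>. \<forall>C\<in>F. csat \<phi> C)"
  by (simp add: satisfiable_def csat_def)

lemma csat_mono: "csat \<phi> C \<Longrightarrow> C \<subseteq> D \<Longrightarrow> csat \<phi> D"
  by (auto simp: csat_def)

lemma csat_make_trueD: "csat \<phi> D \<Longrightarrow> \<not> csat (make_true x \<phi>) D \<Longrightarrow> comp x \<in> D"
  by (auto simp: csat_def lit_true_make_true)

lemma csat_make_true_self: "x \<in> D \<Longrightarrow> csat (make_true x \<phi>) D"
  by (auto simp: csat_def lit_true_make_true)

section \<open>Minimally unsatisfiable clause-sets\<close>

lemma MU_finite: "F \<in> MU \<Longrightarrow> finite F"
  by (simp add: MU_def is_clauseset_def)

lemma MU_clause: "F \<in> MU \<Longrightarrow> C \<in> F \<Longrightarrow> is_clause C"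
  by (simp add: MU_def is_clauseset_def)

lemma MU_no_clash: "F \<in> MU \<Longrightarrow> C \<in> F \<Longrightarrow> x \<in> C \<Longrightarrow> comp x \<notin> C"
  using MU_clause is_clause_def by blast

lemma MU_unsat: "F \<in> MU \<Longrightarrow> \<exists>C\<in>F. \<not> csat \<phi> C"
  by (auto simp: MU_def satisfiable_csat)

lemma MU_finite_var: "F \<in> MU \<Longrightarrow> finite (var F)"
  by (auto simp: var_def var_clause_def MU_finite dest: MU_clause simp: is_clause_def)

lemma MU_critical:
  assumes "F \<in> MU" "D \<in> F"
  obtains \<phi> where "\<not> csat \<phi> D" "\<And>C. C \<in> F \<Longrightarrow> C \<noteq> D \<Longrightarrow> csat \<phi> C"
proof -
  obtain \<phi> where \<phi>: "\<forall>C\<in>F - {D}. csat \<phi> C"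
    using assms by (auto simp: MU_def satisfiable_csat)
  moreover from \<phi> have "\<not> csat \<phi> D"
    using MU_unsat[OF assms(1), of \<phi>] by blast
  ultimately show ?thesis using that by blast
qed

text \<open>Substitution, literal insertion and literal assignment all map clauses to clauses. An
  assignment falsifying the image of exactly one index separates this image from the others, which
  gives injectivity and minimality together.\<close>

lemma MU_imageI:
  assumes "finite A" and "\<And>a. a \<in> A \<Longrightarrow> is_clause (f a)"
    and unsat: "\<And>\<phi>. \<exists>a\<in>A. \<not> csat \<phi> (f a)"
    and crit: "\<And>a. a \<in> A \<Longrightarrow> \<exists>\<phi>. \<not> csat \<phi> (f a) \<and> (\<forall>b\<in>A. b \<noteq> a \<longrightarrow> csat \<phi> (f b))"
  shows "f ` A \<in> MU" and "inj_on f A"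
proof -
  show inj: "inj_on f A"
  proof (rule inj_onI)
    fix a b assume "a \<in> A" "b \<in> A" "f a = f b"
    then show "a = b" using crit[of a] by metis
  qed
  have "satisfiable (f ` A - {f a})" if "a \<in> A" for a
    using crit[OF that] unfolding satisfiable_csat by force
  then show "f ` A \<in> MU"
    using assms(1,2) unsat by (auto simp: MU_def is_clauseset_def satisfiable_csat)
qed

text \<open>Making \<open>x\<close> true in an assignment that falsifies only \<open>C\<close> must
  falsify another clause, and a clause can only become false by containing
  \<open>comp x\<close>.\<close>

lemma MU_comp_occurs:
  assumes "F \<in> MU" "C \<in> F" "x \<in> C"
  obtains D where "D \<in> F" "comp x \<in> D"
proof -
  obtain \<phi> where \<phi>: "\<not> csat \<phi> C" "\<And>D. D \<in> F \<Longrightarrow> D \<noteq> C \<Longrightarrow> csat \<phi> D"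
    using MU_critical[OF assms(1,2)] by blast
  obtain D where D: "D \<in> F" "\<not> csat (make_true x \<phi>) D"
    using MU_unsat[OF assms(1)] by blast
  with assms(3) have "D \<noteq> C" using csat_make_true_self by blast
  with \<phi> D have "comp x \<in> D" using csat_make_trueD by blast
  with D that show ?thesis by blast
qed

lemma var_iff: "u \<in> var F \<longleftrightarrow> (\<exists>C\<in>F. \<exists>x\<in>C. var_lit x = u)"
  by (auto simp: var_def var_clause_def)

lemma var_memI: "C \<in> F \<Longrightarrow> x \<in> C \<Longrightarrow> var_lit x \<in> var F"
  by (auto simp: var_iff)

lemma var_clause_iff: "var_lit x \<in> var_clause D \<longleftrightarrow> x \<in> D \<or> comp x \<in> D"
proof
  assume "var_lit x \<in> var_clause D"
  then obtain y where "y \<in> D" "var_lit x = var_lit y" by (auto simp: var_clause_def)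
  then show "x \<in> D \<or> comp x \<in> D" by (auto simp: var_lit_eq_iff)
next
  assume "x \<in> D \<or> comp x \<in> D"
  then have "var_lit x \<in> var_lit ` D \<or> var_lit (comp x) \<in> var_lit ` D" by blast
  then show "var_lit x \<in> var_clause D" by (simp add: var_clause_def)
qed

lemma MU_lit_occurs:
  assumes "F \<in> MU" "var_lit x \<in> var F"
  obtains C where "C \<in> F" "x \<in> C"
proof -
  obtain C y where "C \<in> F" "y \<in> C" "var_lit y = var_lit x"
    using assms(2) by (auto simp: var_iff)
  then show ?thesis
    using that MU_comp_occurs[OF assms(1)] var_lit_eq_iff by (metis comp_comp)
qed

lemma MU_ldeg_pos:
  assumes "F \<in> MU" "var_lit x \<in> var F"
  shows "0 < ldeg F x"
proof -
  obtain C where "C \<in> F" "x \<in> C" using MU_lit_occurs[OF assms] .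
  then show ?thesis using MU_finite[OF assms(1)] by (auto simp: ldeg_def card_gt_0_iff)
qed

section \<open>Literals occurring exactly once and singular DP-reduction\<close>

definition occurs_once :: "'v cls \<Rightarrow> 'v lit \<Rightarrow> 'v clause \<Rightarrow> bool" where
  "occurs_once F x C \<longleftrightarrow> C \<in> F \<and> x \<in> C \<and> (\<forall>D\<in>F. x \<in> D \<longrightarrow> D = C)"

text \<open>Resolution with \<open>C\<close>, extended by the identity to clauses without
  \<open>comp x\<close>, so that a reduction step is the image under one function.\<close>

definition subst_neg :: "'v lit \<Rightarrow> 'v clause \<Rightarrow> 'v clause \<Rightarrow> 'v clause" where
  "subst_neg x C D = (if comp x \<in> D then (D - {comp x}) \<union> (C - {x}) else D)"

lemma ldeg_eq_1_iff: "ldeg F x = 1 \<longleftrightarrow> (\<exists>C. occurs_once F x C)"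
  unfolding ldeg_def occurs_once_def One_nat_def card_1_singleton_iff by blast

lemma occurs_onceD:
  assumes "occurs_once F x C"
  shows "C \<in> F" "x \<in> C" "\<And>D. D \<in> F \<Longrightarrow> x \<in> D \<Longrightarrow> D = C"
  using assms by (auto simp: occurs_once_def)

lemma occurs_once_var: "occurs_once F x C \<Longrightarrow> var_lit x \<in> var F"
  using var_memI occurs_onceD(1,2) by metis

lemma singular_iff:
  assumes "F \<in> MU"
  shows "singular F v \<longleftrightarrow> (\<exists>x C. var_lit x = v \<and> occurs_once F x C)"
proof
  assume "singular F v"
  then have "ldeg F (Pos v) = 1 \<or> ldeg F (Neg v) = 1"
    by (auto simp: singular_def min_def split: if_splits)
  then show "\<exists>x C. var_lit x = v \<and> occurs_once F x C"
    unfolding ldeg_eq_1_iff by (metis var_lit.simps)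
next
  assume "\<exists>x C. var_lit x = v \<and> occurs_once F x C"
  then obtain x C where x: "var_lit x = v" "occurs_once F x C" by blast
  then have "v \<in> var F" using occurs_once_var by blast
  then have "0 < ldeg F (Pos v)" "0 < ldeg F (Neg v)"
    using MU_ldeg_pos[OF assms] by simp_all
  moreover have "ldeg F (Pos v) = 1 \<or> ldeg F (Neg v) = 1"
    using x ldeg_eq_1_iff by (metis var_lit.elims)
  ultimately show "singular F v" by (auto simp: singular_def min_def)
qed

lemma occurs_once_comp_occurs:
  assumes "F \<in> MU" "occurs_once F x C"
  obtains D where "D \<in> F - {C}" "comp x \<in> D"
  using MU_comp_occurs[OF assms(1)] MU_no_clash[OF assms(1)] assms(2)
  by (metis DiffI occurs_onceD(1,2) singletonD)

text \<open>Take an assignment falsifying only \<open>D\<close> and make \<open>x\<close> false. The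
  clause now falsified contains \<open>x\<close>, so it is \<open>C\<close>; but a literal of
  \<open>C\<close> whose complement lies in \<open>D\<close> was true and stays true unless it is
  \<open>x\<close>.\<close>

lemma occurs_once_clash:
  assumes "F \<in> MU" "occurs_once F x C" "D \<in> F" "comp x \<in> D"
  shows "C \<inter> comp ` D = {x}"
proof -
  note C = occurs_onceD[OF assms(2)]
  obtain \<phi> where \<phi>: "\<not> csat \<phi> D" "\<And>E. E \<in> F \<Longrightarrow> E \<noteq> D \<Longrightarrow> csat \<phi> E"
    using MU_critical[OF assms(1,3)] by blast
  let ?\<psi> = "make_true (comp x) \<phi>"
  obtain E where E: "E \<in> F" "\<not> csat ?\<psi> E"
    using MU_unsat[OF assms(1)] by blast
  then have "E \<noteq> D" using assms(4) csat_make_true_self by blast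
  with \<phi> E have "x \<in> E" using csat_make_trueD[of \<phi> E "comp x"] by simp
  with C E have [simp]: "E = C" by blast
  have "z = x" if "z \<in> C" "comp z \<in> D" for z
  proof -
    have "lit_true \<phi> z" using \<phi>(1) that(2) unfolding csat_def by (metis lit_true_comp)
    then show ?thesis
      using that(1) E(2) by (auto simp: csat_def lit_true_make_true)
  qed
  then have "C \<inter> comp ` D \<subseteq> {x}" by force
  moreover have "x \<in> comp ` D" using imageI[OF assms(4), of comp] by simp
  ultimately show ?thesis using C(2) by blast
qed

lemma occurs_once_clashD:
  assumes "F \<in> MU" "occurs_once F x C" "D \<in> F" "comp x \<in> D" "z \<in> C" "comp z \<in> D"
  shows "z = x"
proof -
  have "comp (comp z) \<in> comp ` D" using assms(6) by (rule imageI)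
  then show ?thesis using occurs_once_clash[OF assms(1-4)] assms(5) by auto
qed

text \<open>By \<open>occurs_once_clash\<close> every clause with \<open>comp x\<close> does resolve
  with \<open>C\<close>, and \<open>C\<close> is the only possible partner.\<close>

lemma DP_eq_subst_neg:
  assumes "F \<in> MU" "occurs_once F x C"
  shows "DP (var_lit x) F = subst_neg x C ` (F - {C})"
proof -
  note C = occurs_onceD[OF assms(2)]
  have nC: "comp x \<notin> C" using MU_no_clash[OF assms(1)] C by blast
  have res: "C \<union> D - {x, comp x} = subst_neg x C D" if "D \<in> F" "comp x \<in> D" for D
    using MU_no_clash[OF assms(1) that] nC that by (auto simp: subst_neg_def)
  have var: "{D \<in> F. var_lit x \<notin> var_clause D} = {D \<in> F - {C}. comp x \<notin> D}"
    using C nC unfolding var_clause_iff by blast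
  have "{(A \<union> D) - {Pos (var_lit x), Neg (var_lit x)} | A D.
       A \<in> F \<and> D \<in> F \<and> A \<inter> comp ` D = {Pos (var_lit x)}}
     = {C \<union> D - {x, comp x} | D. D \<in> F \<and> comp x \<in> D}" (is "?L = ?R")
  proof (cases x)
    case (Pos v)
    have "A = C \<and> comp x \<in> D" if "A \<in> F" "A \<inter> comp ` D = {Pos v}" for A D
    proof -
      have "Pos v \<in> A" "Pos v \<in> comp ` D" using that by blast+
      then show ?thesis using Pos C(3)[OF that(1)] by (auto simp: mem_comp_image)
    qed
    then have "A \<in> F \<and> D \<in> F \<and> A \<inter> comp ` D = {Pos v} \<longleftrightarrow> A = C \<and> D \<in> F \<and> comp x \<in> D" for A D
      using Pos C(1) occurs_once_clash[OF assms, of D] by blast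
    then show ?thesis using Pos by simp
  next
    \<comment> \<open>\<open>DP\<close> lists the parent with the positive literal first, so here
      \<open>C\<close> is the second parent and the clash has to be transposed.\<close>
    case (Neg v)
    have *: "D = C \<and> comp x \<in> A" if "D \<in> F" "A \<inter> comp ` D = {Pos v}" for A D
    proof -
      have "Pos v \<in> A" "Pos v \<in> comp ` D" using that by blast+
      then show ?thesis using Neg C(3)[OF that(1)] by (auto simp: mem_comp_image)
    qed
    have **: "D \<inter> comp ` C = {Pos v}" if "D \<in> F" "comp x \<in> D" for D
    proof -
      have "C \<inter> comp ` D = {x}" using occurs_once_clash[OF assms that] .
      then have "comp ` (C \<inter> comp ` D) = {comp x}" by simp
      moreover have "comp ` (C \<inter> comp ` D) = D \<inter> comp ` C"
        by (auto simp: mem_comp_image)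
      ultimately show ?thesis using Neg by simp
    qed
    have "A \<in> F \<and> D \<in> F \<and> A \<inter> comp ` D = {Pos v} \<longleftrightarrow> D = C \<and> A \<in> F \<and> comp x \<in> A" for A D
      using C(1) *[of D A] **[of A] by metis
    then have "?L = {A \<union> C - {x, comp x} | A. A \<in> F \<and> comp x \<in> A}"
      using Neg by (simp add: insert_commute[of "Pos v"])
    then show ?thesis by (simp only: Un_commute[of C])
  qed
  also have "\<dots> = subst_neg x C ` {D \<in> F - {C}. comp x \<in> D}"
  proof -
    have "{D \<in> F - {C}. comp x \<in> D} = {D \<in> F. comp x \<in> D}" using nC by blast
    moreover have "{C \<union> D - {x, comp x} | D. D \<in> F \<and> comp x \<in> D}
        = (\<lambda>D. C \<union> D - {x, comp x}) ` {D \<in> F. comp x \<in> D}" by blast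
    moreover have "\<dots> = subst_neg x C ` {D \<in> F. comp x \<in> D}"
      using res by (intro image_cong) auto
    ultimately show ?thesis by simp
  qed
  finally have "DP (var_lit x) F
      = {D \<in> F - {C}. comp x \<notin> D} \<union> subst_neg x C ` {D \<in> F - {C}. comp x \<in> D}"
    unfolding DP_def var by simp
  also have "{D \<in> F - {C}. comp x \<notin> D} = subst_neg x C ` {D \<in> F - {C}. comp x \<notin> D}"
    by (simp add: subst_neg_def)
  finally show ?thesis by (simp only: image_Un[symmetric]) (rule arg_cong, blast)
qed

text \<open>An assignment falsifying only \<open>D\<close> also falsifies only the image of
  \<open>D\<close>: if \<open>comp x\<close> is in \<open>D\<close>, making \<open>x\<close> false
  shows that all of \<open>C - {x}\<close> is false. The other images stay true, since a resolvent
  drops only \<open>x\<close> and \<open>comp x\<close>, which are not both true.\<close>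

lemma subst_neg_MU:
  assumes "F \<in> MU" "occurs_once F x C"
  shows "subst_neg x C ` (F - {C}) \<in> MU" and "inj_on (subst_neg x C) (F - {C})"
proof -
  note C = occurs_onceD[OF assms(2)]
  have fin: "finite (F - {C})" using MU_finite[OF assms(1)] by simp
  have cl: "is_clause (subst_neg x C D)" if "D \<in> F - {C}" for D
  proof (cases "comp x \<in> D")
    case True
    have "z = x" if "z \<in> C" "comp z \<in> D" for z
      using occurs_once_clashD[OF assms _ True that] \<open>D \<in> F - {C}\<close> by blast
    then show ?thesis
      using MU_clause[OF assms(1)] C(1) that
      unfolding is_clause_def subst_neg_def by (auto simp: comp_eq_swap)
  qed (use MU_clause[OF assms(1)] that in \<open>simp add: subst_neg_def\<close>)
  have unsat: "\<exists>D\<in>F - {C}. \<not> csat \<phi> (subst_neg x C D)" for \<phi>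
  proof (rule ccontr)
    assume "\<not> ?thesis"
    then have *: "csat \<phi> (subst_neg x C D)" if "D \<in> F" "D \<noteq> C" for D using that by blast
    show False
    \<comment> \<open>The value of \<open>x\<close> is dictated by \<open>C\<close>: if the rest of
      \<open>C\<close> is true, \<open>x\<close> can be made false, otherwise it is made true;
      either way all of \<open>F\<close> becomes true.\<close>
    proof (cases "csat \<phi> (C - {x})")
      case True
      have "csat (make_true (comp x) \<phi>) D" if "D \<in> F" for D
      proof (cases "D = C \<or> comp x \<in> D")
        case True
        then show ?thesis
          using \<open>csat \<phi> (C - {x})\<close> csat_make_true_self
          by (auto simp: csat_def lit_true_make_true)
      next
        case False
        then have "x \<notin> D" "csat \<phi> D" using *[OF that] C(3)[OF that] by (auto simp: subst_neg_def)
        then show ?thesis by (auto simp: csat_def lit_true_make_true)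
      qed
      then show False using MU_unsat[OF assms(1)] by blast
    next
      case False
      have "csat (make_true x \<phi>) D" if "D \<in> F" for D
        using *[OF that] False C(2)
        by (cases "D = C") (auto simp: csat_def subst_neg_def lit_true_make_true split: if_splits)
      then show False using MU_unsat[OF assms(1)] by blast
    qed
  qed
  have crit: "\<exists>\<phi>. \<not> csat \<phi> (subst_neg x C D) \<and>
      (\<forall>E\<in>F - {C}. E \<noteq> D \<longrightarrow> csat \<phi> (subst_neg x C E))" if D: "D \<in> F - {C}" for D
  proof -
    obtain \<phi> where \<phi>: "\<not> csat \<phi> D" "\<And>E. E \<in> F \<Longrightarrow> E \<noteq> D \<Longrightarrow> csat \<phi> E"
      using MU_critical[OF assms(1)] D by blast
    have "\<not> csat \<phi> (subst_neg x C D)"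
    proof (cases "comp x \<in> D")
      case True
      then have x: "lit_true \<phi> x" using \<phi>(1) by (auto simp: csat_def)
      obtain E where E: "E \<in> F" "\<not> csat (make_true (comp x) \<phi>) E"
        using MU_unsat[OF assms(1)] by blast
      then have "E \<noteq> D" using True csat_make_true_self by blast
      with \<phi> E have "x \<in> E" using csat_make_trueD[of \<phi> E "comp x"] by simp
      with C E have "E = C" by blast
      then show ?thesis using E(2) \<phi>(1) True
        by (auto simp: csat_def lit_true_make_true subst_neg_def)
    qed (use \<phi> in \<open>simp add: subst_neg_def\<close>)
    moreover have "csat \<phi> (subst_neg x C E)" if "E \<in> F - {C}" "E \<noteq> D" for E
    proof -
      have "csat \<phi> E" "csat \<phi> C" using \<phi>(2) that C(1) D by blast+
      then obtain e c where "e \<in> E" "lit_true \<phi> e" "c \<in> C" "lit_true \<phi> c"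
        unfolding csat_def by blast
      then have "e \<in> subst_neg x C E \<or> c \<in> subst_neg x C E"
        by (auto simp: subst_neg_def)
      then show ?thesis
        using \<open>lit_true \<phi> e\<close> \<open>lit_true \<phi> c\<close> unfolding csat_def by blast
    qed
    ultimately show ?thesis by blast
  qed
  show "subst_neg x C ` (F - {C}) \<in> MU" "inj_on (subst_neg x C) (F - {C})"
    using MU_imageI[OF fin cl unsat crit] by blast+
qed

lemma subst_neg_no_var:
  assumes "F \<in> MU" "occurs_once F x C" "D \<in> F - {C}"
  shows "x \<notin> subst_neg x C D" "comp x \<notin> subst_neg x C D"
proof -
  have "x \<notin> D" "comp x \<notin> C"
    using assms(3) occurs_onceD[OF assms(2)] MU_no_clash[OF assms(1)] by blast+
  then show "x \<notin> subst_neg x C D" "comp x \<notin> subst_neg x C D"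
    by (auto simp: subst_neg_def)
qed

lemma var_subst_neg:
  assumes "F \<in> MU" "occurs_once F x C"
  shows "var (subst_neg x C ` (F - {C})) = var F - {var_lit x}"
proof (intro set_eqI iffI)
  note C = occurs_onceD[OF assms(2)]
  fix u
  assume "u \<in> var (subst_neg x C ` (F - {C}))"
  then obtain D y where D: "D \<in> F - {C}" "y \<in> subst_neg x C D" "var_lit y = u"
    by (auto simp: var_iff)
  then have "u \<noteq> var_lit x" using subst_neg_no_var[OF assms D(1)] var_lit_eq_iff by metis
  moreover have "u \<in> var F" using D C(1) by (auto simp: var_iff subst_neg_def split: if_splits)
  ultimately show "u \<in> var F - {var_lit x}" by simp
next
  note C = occurs_onceD[OF assms(2)]
  fix u
  assume u: "u \<in> var F - {var_lit x}"
  then obtain D y where D: "D \<in> F" "y \<in> D" "var_lit y = u" by (auto simp: var_iff)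
  \<comment> \<open>Variables occurring only in the deleted clause \<open>C\<close> survive in the
    image of a clause with \<open>comp x\<close>.\<close>
  obtain D1 where D1: "D1 \<in> F - {C}" "comp x \<in> D1" using occurs_once_comp_occurs[OF assms] .
  have y: "y \<noteq> x" "y \<noteq> comp x" using u D by auto
  have "y \<in> subst_neg x C (if D = C then D1 else D)"
    using D y D1 by (auto simp: subst_neg_def)
  moreover have "(if D = C then D1 else D) \<in> F - {C}" using D D1 by auto
  ultimately show "u \<in> var (subst_neg x C ` (F - {C}))" using D(3) by (auto simp only: var_iff)
qed

lemma DP_occurs_once:
  assumes "F \<in> MU" "occurs_once F x C"
  shows "DP (var_lit x) F \<in> MU" and "deficiency (DP (var_lit x) F) = deficiency F"
    and "card (DP (var_lit x) F) < card F"
proof -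
  note C = occurs_onceD[OF assms(2)]
  note DP = DP_eq_subst_neg[OF assms]
  show "DP (var_lit x) F \<in> MU" using subst_neg_MU[OF assms] DP by simp
  have "card (DP (var_lit x) F) = card (F - {C})"
    using subst_neg_MU(2)[OF assms] DP by (simp add: card_image)
  then have c: "card F = Suc (card (DP (var_lit x) F))"
    using MU_finite[OF assms(1)] C(1) by (metis card_Suc_Diff1)
  then show "card (DP (var_lit x) F) < card F" by simp
  have "var_lit x \<in> var F" using C by (auto simp: var_iff)
  then have "card (var F) = Suc (card (var (DP (var_lit x) F)))"
    using var_subst_neg[OF assms] MU_finite_var[OF assms(1)] DP by (metis card_Suc_Diff1)
  with c show "deficiency (DP (var_lit x) F) = deficiency F"
    by (simp add: deficiency_def c_cls_def n_vars_def)
qed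

lemma DP_singular:
  assumes "F \<in> MU" "singular F v"
  shows "DP v F \<in> MU" and "deficiency (DP v F) = deficiency F" and "card (DP v F) < card F"
  using assms DP_occurs_once singular_iff by metis+

section \<open>Commutation\<close>

text \<open>As \<open>y\<close> occurs only in \<open>E\<close>, it is not in \<open>C\<close>, so
  the substitution neither copies nor deletes it.\<close>

lemma occurs_once_subst_neg:
  assumes "F \<in> MU" "occurs_once F x C" "occurs_once F y E" "C \<noteq> E" "var_lit x \<noteq> var_lit y"
  shows "occurs_once (DP (var_lit x) F) y (subst_neg x C E)"
proof -
  note C = occurs_onceD[OF assms(2)] and E = occurs_onceD[OF assms(3)]
  have "y \<in> subst_neg x C E" using E(2) assms(5) by (auto simp: subst_neg_def)
  moreover have "D = E" if "D \<in> F - {C}" "y \<in> subst_neg x C D" for D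
  proof -
    have "y \<notin> C" using C(1) E(3) assms(4) by blast
    then have "y \<in> D" using that(2) by (auto simp: subst_neg_def split: if_splits)
    then show ?thesis using E(3) that(1) by blast
  qed
  ultimately show ?thesis
    using E(1) assms(4) unfolding DP_eq_subst_neg[OF assms(1,2)] occurs_once_def by blast
qed

lemma DP_DP_subst_neg:
  assumes "F \<in> MU" "occurs_once F x C" "occurs_once F y E" "C \<noteq> E" "var_lit x \<noteq> var_lit y"
  shows "DP (var_lit y) (DP (var_lit x) F)
    = (\<lambda>D. subst_neg y (subst_neg x C E) (subst_neg x C D)) ` (F - {C, E})"
proof -
  let ?G = "DP (var_lit x) F"
  have G: "?G = subst_neg x C ` (F - {C})" using DP_eq_subst_neg[OF assms(1,2)] .
  have "?G - {subst_neg x C E} = subst_neg x C ` (F - {C} - {E})"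
    using inj_on_image_set_diff[OF subst_neg_MU(2)[OF assms(1,2)], of "F - {C}" "{E}"]
      occurs_onceD(1)[OF assms(3)] assms(4) G by auto
  moreover have "F - {C} - {E} = F - {C, E}" by blast
  ultimately show ?thesis
    using DP_eq_subst_neg[OF DP_occurs_once(1)[OF assms(1,2)] occurs_once_subst_neg[OF assms]]
    by (simp add: image_image)
qed

lemma DP_commute:
  assumes "F \<in> MU" "occurs_once F x C" "occurs_once F y E" "C \<noteq> E" "var_lit x \<noteq> var_lit y"
  shows "DP (var_lit y) (DP (var_lit x) F) = DP (var_lit x) (DP (var_lit y) F)"
proof -
  note C = occurs_onceD[OF assms(2)] and E = occurs_onceD[OF assms(3)]
  have ne: "x \<noteq> y" "x \<noteq> comp y" "y \<noteq> comp x" using assms(5) by auto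
  \<comment> \<open>The two orders agree clause by clause unless each of \<open>C\<close> and
    \<open>E\<close> contains the literal for which the other is substituted; then they would clash
    on two variables.\<close>
  have not_both: "\<not> (comp x \<in> E \<and> comp y \<in> C)"
  proof
    assume a: "comp x \<in> E \<and> comp y \<in> C"
    then have "C \<inter> comp ` E = {x}" using occurs_once_clash[OF assms(1,2) E(1)] by blast
    moreover have "comp y \<in> C \<inter> comp ` E" using a E(2) by blast
    ultimately show False using ne by auto
  qed
  have mem: "comp x \<notin> C" "comp y \<notin> E" "x \<notin> E" "y \<notin> C"
    using MU_no_clash[OF assms(1)] C E assms(4) by blast+
  have "subst_neg y (subst_neg x C E) (subst_neg x C D) = subst_neg x (subst_neg y E C) (subst_neg y E D)"
    if "D \<in> F - {C, E}" for D
  proof -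
    have "x \<notin> D" "y \<notin> D" using that C E by blast+
    then show ?thesis
      using not_both mem ne unfolding subst_neg_def by (auto split: if_splits)
  qed
  moreover have "F - {E, C} = F - {C, E}" by blast
  ultimately show ?thesis
    using DP_DP_subst_neg[OF assms] DP_DP_subst_neg[OF assms(1,3,2) assms(4,5)[symmetric]]
    by (auto intro!: image_cong)
qed

section \<open>Positivity of the deficiency\<close>

text \<open>Induction of Halmos and Vaughan: if all nonempty proper subfamilies have a surplus, any
  choice for one index keeps the condition; otherwise a tight subfamily is matched first, and the
  rest satisfies the condition outside its union.\<close>

theorem hall_marriage:
  fixes A :: "'i \<Rightarrow> 'a set"
  assumes "finite I" "\<And>i. i \<in> I \<Longrightarrow> finite (A i)"
    and "\<And>J. J \<subseteq> I \<Longrightarrow> card J \<le> card (\<Union> (A ` J))"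
  shows "\<exists>f. inj_on f I \<and> (\<forall>i\<in>I. f i \<in> A i)"
  using assms
proof (induction I arbitrary: A rule: finite_psubset_induct)
  case (psubset I)
  have fin: "finite (\<Union> (A ` J))" if "J \<subseteq> I" for J
    using that psubset.hyps psubset.prems(1) finite_subset[OF that] by auto
  consider "I = {}" | i where "i \<in> I" "\<And>J. J \<subset> I \<Longrightarrow> J \<noteq> {} \<Longrightarrow> card J < card (\<Union> (A ` J))"
    | J where "J \<subset> I" "J \<noteq> {}" "card J = card (\<Union> (A ` J))"
    using psubset.prems(2) by (metis all_not_in_conv nless_le psubset_imp_subset)
  then show ?case
  proof cases
    case 1
    then show ?thesis by auto
  next
    case (2 i)
    have "card {i} \<le> card (\<Union> (A ` {i}))" using psubset.prems(2) 2(1) by blast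
    then obtain a where a: "a \<in> A i" by fastforce
    have "\<exists>f. inj_on f (I - {i}) \<and> (\<forall>j\<in>I - {i}. f j \<in> A j - {a})"
    proof (rule psubset.IH)
      show "I - {i} \<subset> I" using 2(1) by blast
      show "finite (A j - {a})" if "j \<in> I - {i}" for j using that psubset.prems(1) by blast
      fix J assume J: "J \<subseteq> I - {i}"
      show "card J \<le> card (\<Union>j\<in>J. A j - {a})"
      proof (cases "J = {}")
        case False
        then have "card J < card (\<Union> (A ` J))" using 2 J by blast
        moreover have "(\<Union>j\<in>J. A j - {a}) = \<Union> (A ` J) - {a}" by blast
        ultimately show ?thesis
          using diff_card_le_card_Diff[of "{a}" "\<Union> (A ` J)"] by simp
      qed simp
    qed
    then obtain f where f: "inj_on f (I - {i})" "\<forall>j\<in>I - {i}. f j \<in> A j - {a}" by blast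
    have "inj_on (f(i := a)) I" using f by (fastforce simp: inj_on_def)
    moreover have "\<forall>j\<in>I. (f(i := a)) j \<in> A j" using f a by auto
    ultimately show ?thesis by blast
  next
    case (3 J)
    let ?U = "\<Union> (A ` J)"
    have "\<exists>f. inj_on f J \<and> (\<forall>j\<in>J. f j \<in> A j)"
      using 3 psubset.prems by (intro psubset.IH) auto
    then obtain f where f: "inj_on f J" "\<forall>j\<in>J. f j \<in> A j" by blast
    have "\<exists>g. inj_on g (I - J) \<and> (\<forall>j\<in>I - J. g j \<in> A j - ?U)"
    proof (rule psubset.IH)
      show "I - J \<subset> I" using 3 by blast
      show "finite (A j - ?U)" if "j \<in> I - J" for j using that psubset.prems(1) by blast
      fix K assume K: "K \<subseteq> I - J"
      have finJK: "finite J" "finite K"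
        using K 3(1) psubset.hyps by (meson finite_subset finite_Diff psubset_imp_subset)+
      have "card J + card K = card (J \<union> K)"
        using K finJK by (subst card_Un_disjoint) auto
      also have "\<dots> \<le> card (\<Union> (A ` (J \<union> K)))"
        using K 3(1) psubset.prems(2)[of "J \<union> K"] by blast
      also have "\<Union> (A ` (J \<union> K)) = ?U \<union> (\<Union>j\<in>K. A j - ?U)" by blast
      also have "card \<dots> \<le> card ?U + card (\<Union>j\<in>K. A j - ?U)" by (rule card_Un_le)
      finally show "card K \<le> card (\<Union>j\<in>K. A j - ?U)" using 3(3) by simp
    qed
    then obtain g where g: "inj_on g (I - J)" "\<forall>j\<in>I - J. g j \<in> A j - ?U" by blast
    let ?h = "\<lambda>j. if j \<in> J then f j else g j"
    have "inj_on ?h I"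
    proof (rule inj_onI)
      fix j k assume jk: "j \<in> I" "k \<in> I" "?h j = ?h k"
      have "f j \<in> ?U" if "j \<in> J" for j using f that by blast
      with jk g(2) have "j \<in> J \<longleftrightarrow> k \<in> J" by (metis DiffD2 DiffI)
      with jk f(1) g(1) show "j = k" unfolding inj_on_def by (metis DiffI)
    qed
    moreover have "\<forall>j\<in>I. ?h j \<in> A j" using f g by auto
    ultimately show ?thesis by blast
  qed
qed

lemma ex_maximal_on_finite:
  fixes d :: "'a \<Rightarrow> int"
  assumes "finite S" "S \<noteq> {}"
  obtains m where "m \<in> S" "\<And>t. t \<in> S \<Longrightarrow> d t \<le> d m"
proof -
  have "Max (d ` S) \<in> d ` S" using assms by (intro Max_in) auto
  then obtain m where "m \<in> S" "d m = Max (d ` S)" by auto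
  then show ?thesis using that assms by (metis Max_ge finite_imageI imageI)
qed

text \<open>A proper subset of maximal deficiency satisfies Hall's condition for the remaining clauses
  and the variables outside it; hence the remaining clauses can be satisfied independently.\<close>

lemma MU_deficiency_pos:
  assumes "F \<in> MU"
  shows "card (var F) < card F"
proof (rule ccontr)
  assume neg: "\<not> card (var F) < card F"
  define d where "d T = int (card T) - int (card (var T))" for T :: "'a cls"
  have finF: "finite F" using MU_finite[OF assms] .
  have finV: "finite (var T)" if "T \<subseteq> F" for T
    using that MU_finite_var[OF assms] by (rule_tac finite_subset[of _ "var F"]) (auto simp: var_def)
  have "F \<noteq> {}" using MU_unsat[OF assms] by blast
  then have "{T. T \<subset> F} \<noteq> {}" by blast
  moreover have "finite {T. T \<subset> F}" using finF by (auto intro: finite_subset[of _ "Pow F"])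
  ultimately obtain T where T: "T \<subset> F" "\<And>S. S \<subset> F \<Longrightarrow> d S \<le> d T"
    using ex_maximal_on_finite[of "{T. T \<subset> F}" d] by auto
  \<comment> \<open>The empty subset makes the maximum over proper subsets nonnegative, so
    \<open>T\<close> is maximal among all subsets, \<open>F\<close> included.\<close>
  have "d F \<le> 0" using neg by (simp add: d_def)
  moreover have "0 \<le> d T" using T(2)[of "{}"] \<open>F \<noteq> {}\<close> by (auto simp: d_def var_def)
  ultimately have dT: "d S \<le> d T" if "S \<subseteq> F" for S
    using that T(2)[of S] by (cases "S = F") auto
  let ?A = "\<lambda>C. var_clause C - var T"
  have "\<exists>f. inj_on f (F - T) \<and> (\<forall>C\<in>F - T. f C \<in> ?A C)"
  proof (rule hall_marriage)
    show "finite (F - T)" using finF by blast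
    show "finite (?A C)" if "C \<in> F - T" for C
      using that MU_clause[OF assms, of C] by (auto simp: var_clause_def is_clause_def)
    fix J assume J: "J \<subseteq> F - T"
    have fin: "finite T" "finite J" using J T(1) finF by (auto dest: finite_subset)
    have "card (T \<union> J) = card T + card J" using fin J by (intro card_Un_disjoint) auto
    moreover have "card (var (T \<union> J)) = card (var T) + card (\<Union> (?A ` J))"
    proof -
      have "var (T \<union> J) = var T \<union> \<Union> (?A ` J)" by (auto simp: var_def)
      moreover have "T \<subseteq> F" "T \<union> J \<subseteq> F" using J T(1) by blast+
      then have "finite (var T)" "finite (var (T \<union> J))" by (auto intro: finV)
      moreover have "var T \<inter> \<Union> (?A ` J) = {}" by blast
      ultimately show ?thesis by (metis card_Un_disjoint finite_Un)
    qed
    moreover have "d (T \<union> J) \<le> d T" using dT[of "T \<union> J"] J T(1) by blast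
    ultimately show "card J \<le> card (\<Union> (?A ` J))" by (simp add: d_def)
  qed
  then obtain f where f: "inj_on f (F - T)" "\<And>C. C \<in> F - T \<Longrightarrow> f C \<in> ?A C" by blast
  obtain E where "E \<in> F - T" using T(1) by blast
  then obtain \<phi> where \<phi>: "\<And>C. C \<in> T \<Longrightarrow> csat \<phi> C"
    using MU_critical[OF assms, of E] T(1) by (metis DiffD1 DiffD2 psubsetD)
  \<comment> \<open>Each clause \<open>C\<close> outside \<open>T\<close> owns the variable
    \<open>f C\<close>, which is not in \<open>var T\<close> and is set so as to satisfy
    \<open>C\<close>; all other variables keep the value that satisfies \<open>T\<close>.\<close>
  define \<psi> where "\<psi> v = (if v \<in> f ` (F - T) then \<exists>C\<in>F - T. f C = v \<and> Pos v \<in> C else \<phi> v)" for v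
  have "csat \<psi> C" if "C \<in> F" for C
  proof (cases "C \<in> T")
    case True
    then have "csat \<phi> C" using \<phi> by simp
    then obtain x where x: "x \<in> C" "lit_true \<phi> x" unfolding csat_def by blast
    then have "var_lit x \<in> var T" using True by (auto simp: var_iff)
    moreover have "f D \<notin> var T" if "D \<in> F - T" for D using f(2)[OF that] by simp
    ultimately have "var_lit x \<notin> f ` (F - T)" by (metis imageE)
    then have "lit_true \<psi> x" using x(2) by (cases x) (auto simp: lit_true_def \<psi>_def)
    then show ?thesis using x(1) by (auto simp: csat_def)
  next
    case False
    then have C: "C \<in> F - T" using that by blast
    let ?v = "f C"
    have "?v \<in> var_clause C" using f(2)[OF C] by blast
    then have "Pos ?v \<in> C \<or> Neg ?v \<in> C" using var_clause_iff[of "Pos ?v" C] by simp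
    moreover have "\<psi> ?v \<longleftrightarrow> Pos ?v \<in> C"
      using C f(1) unfolding \<psi>_def inj_on_def by (metis imageI)
    ultimately show ?thesis
      unfolding csat_def lit_true_def by (metis lit.simps(5,6))
  qed
  then show False using MU_unsat[OF assms] by blast
qed

section \<open>Saturation and splitting\<close>

text \<open>Only literals over \<open>var F\<close> are tested, so that saturating keeps the
  variables and hence the deficiency.\<close>

definition saturated :: "'v cls \<Rightarrow> bool" where
  "saturated F \<longleftrightarrow> (\<forall>C\<in>F. \<forall>l. l \<notin> C \<longrightarrow> comp l \<notin> C \<longrightarrow> var_lit l \<in> var F \<longrightarrow>
     satisfiable (insert (insert l C) (F - {C})))"

text \<open>Under an assignment falsifying only \<open>D\<close>, the other clauses stay true when a
  clause grows; unsatisfiability then forces the image of \<open>D\<close> to stay false.\<close>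

lemma MU_insert_lit:
  assumes "F \<in> MU" "C \<in> F" "l \<notin> C" "comp l \<notin> C" "var_lit l \<in> var F"
    and "\<not> satisfiable (insert (insert l C) (F - {C}))"
  obtains G where "G \<in> MU" "card G = card F" "var G = var F"
    "\<And>x. ldeg F x \<le> ldeg G x" "ldeg F l < ldeg G l"
proof
  define f where "f D = (if D = C then insert l C else D)" for D
  have G: "insert (insert l C) (F - {C}) = f ` F"
    using assms(2) by (auto simp: f_def image_iff)
  have fin: "finite F" using MU_finite[OF assms(1)] .
  have cl: "is_clause (f D)" if "D \<in> F" for D
    using MU_clause[OF assms(1) that] assms(3,4) by (auto simp: is_clause_def f_def comp_eq_swap)
  have unsat: "\<exists>D\<in>F. \<not> csat \<phi> (f D)" for \<phi>
    using assms(6) unfolding G satisfiable_csat by blast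
  have crit: "\<exists>\<phi>. \<not> csat \<phi> (f D) \<and> (\<forall>E\<in>F. E \<noteq> D \<longrightarrow> csat \<phi> (f E))" if D: "D \<in> F" for D
  proof -
    obtain \<phi> where \<phi>: "\<not> csat \<phi> D" "\<And>E. E \<in> F \<Longrightarrow> E \<noteq> D \<Longrightarrow> csat \<phi> E"
      using MU_critical[OF assms(1) D] by blast
    have "csat \<phi> (f E)" if "E \<in> F" "E \<noteq> D" for E
      by (rule csat_mono[OF \<phi>(2)[OF that]]) (auto simp: f_def)
    moreover from this have "\<not> csat \<phi> (f D)" using unsat[of \<phi>] by blast
    ultimately show ?thesis by blast
  qed
  note MU = MU_imageI[OF fin cl unsat crit]
  show "f ` F \<in> MU" using MU by blast
  show "card (f ` F) = card F" using MU(2) by (simp add: card_image)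
  show "var (f ` F) = var F"
    using assms(2,5) by (fastforce simp: var_def var_clause_def f_def split: if_splits)
  have ldeg: "ldeg (f ` F) x = card {D \<in> F. x \<in> f D}" for x
  proof -
    have "{D \<in> f ` F. x \<in> D} = f ` {D \<in> F. x \<in> f D}" by blast
    then show ?thesis
      unfolding ldeg_def using MU(2) by (simp add: card_image inj_on_subset)
  qed
  have sub: "{D \<in> F. x \<in> D} \<subseteq> {D \<in> F. x \<in> f D}" for x by (auto simp: f_def)
  show "ldeg F x \<le> ldeg (f ` F) x" for x
    unfolding ldeg using fin by (auto simp: ldeg_def intro!: card_mono sub)
  have "C \<in> {D \<in> F. l \<in> f D} - {D \<in> F. l \<in> D}" using assms(2,3) by (auto simp: f_def)
  with sub[of l] have "{D \<in> F. l \<in> D} \<subset> {D \<in> F. l \<in> f D}" by blast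
  then show "ldeg F l < ldeg (f ` F) l"
    unfolding ldeg using fin by (auto simp: ldeg_def intro!: psubset_card_mono)
qed

lemma finite_lits:
  assumes "finite V"
  shows "finite {x. var_lit x \<in> V}"
proof -
  have "{x. var_lit x \<in> V} \<subseteq> Pos ` V \<union> Neg ` V"
    by (auto simp: image_iff) (metis var_lit.elims)
  then show ?thesis using assms by (meson finite_UnI finite_imageI finite_subset)
qed

lemma ldeg_le_card: "finite F \<Longrightarrow> ldeg F x \<le> card F"
  unfolding ldeg_def by (intro card_mono) auto

text \<open>Each insertion raises a literal degree, and degrees are bounded by the number of
  clauses; the sum of the gaps is the termination measure.\<close>

lemma MU_saturation:
  assumes "F \<in> MU"
  shows "\<exists>G\<in>MU. saturated G \<and> card G = card F \<and> var G = var F \<and> (\<forall>x. ldeg F x \<le> ldeg G x)"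
  using assms
proof (induction "\<Sum>x | var_lit x \<in> var F. card F - ldeg F x" arbitrary: F rule: less_induct)
  case less
  show ?case
  proof (cases "saturated F")
    case False
    then obtain C l where C: "C \<in> F" "l \<notin> C" "comp l \<notin> C" and l: "var_lit l \<in> var F"
      and "\<not> satisfiable (insert (insert l C) (F - {C}))"
      unfolding saturated_def by blast
    then obtain G where G: "G \<in> MU" "card G = card F" "var G = var F"
      "\<And>x. ldeg F x \<le> ldeg G x" "ldeg F l < ldeg G l"
      using MU_insert_lit[OF less.prems] by metis
    have "(\<Sum>x | var_lit x \<in> var G. card G - ldeg G x) < (\<Sum>x | var_lit x \<in> var F. card F - ldeg F x)"
      unfolding G(2,3)
    proof (rule sum_strict_mono_ex1)
      show "finite {x. var_lit x \<in> var F}" using finite_lits MU_finite_var[OF less.prems] .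
      show "\<forall>x\<in>{x. var_lit x \<in> var F}. card F - ldeg G x \<le> card F - ldeg F x"
        using G(4) by (simp add: diff_le_mono2)
      have "ldeg G l \<le> card F" using ldeg_le_card[OF MU_finite[OF G(1)]] G(2) by metis
      then show "\<exists>x\<in>{x. var_lit x \<in> var F}. card F - ldeg G x < card F - ldeg F x"
        using l G(5) by (intro bexI[of _ l]) auto
    qed
    from less.hyps[OF this G(1)] show ?thesis using G(2-4) by (metis order_trans)
  qed (use less.prems in auto)
qed

section \<open>Assigning a literal in a saturated clause-set\<close>

definition assign_lit :: "'v lit \<Rightarrow> 'v cls \<Rightarrow> 'v cls" where
  "assign_lit l F = (\<lambda>D. D - {comp l}) ` {D \<in> F. l \<notin> D}"

text \<open>Every clause \<open>D\<close> without \<open>l\<close> needs a critical assignment with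
  \<open>l\<close> true. If \<open>comp l\<close> is in \<open>D\<close>, each critical assignment
  is of this kind. Otherwise saturation satisfies \<open>insert l D\<close> and all other clauses;
  \<open>D\<close> itself must be false, so \<open>l\<close> is true.\<close>

lemma saturated_assign_lit:
  assumes "F \<in> MU" "saturated F" "var_lit l \<in> var F"
  shows "assign_lit l F \<in> MU" and "inj_on (\<lambda>D. D - {comp l}) {D \<in> F. l \<notin> D}"
proof -
  let ?A = "{D \<in> F. l \<notin> D}" and ?f = "\<lambda>D. D - {comp l}"
  have fin: "finite ?A" using MU_finite[OF assms(1)] by simp
  have cl: "is_clause (?f D)" if "D \<in> ?A" for D
    using MU_clause[OF assms(1), of D] that by (auto simp: is_clause_def)
  have unsat: "\<exists>D\<in>?A. \<not> csat \<phi> (?f D)" for \<phi>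
  proof -
    obtain D where D: "D \<in> F" "\<not> csat (make_true l \<phi>) D" using MU_unsat[OF assms(1)] by blast
    then have "l \<notin> D" using csat_make_true_self by blast
    moreover have "\<not> csat \<phi> (?f D)" using D(2) by (auto simp: csat_def lit_true_make_true)
    ultimately show ?thesis using D(1) by blast
  qed
  have crit: "\<exists>\<phi>. \<not> csat \<phi> (?f D) \<and> (\<forall>E\<in>?A. E \<noteq> D \<longrightarrow> csat \<phi> (?f E))" if D: "D \<in> ?A" for D
  proof -
    have "\<exists>\<phi>. lit_true \<phi> l \<and> \<not> csat \<phi> D \<and> (\<forall>E\<in>F. E \<noteq> D \<longrightarrow> csat \<phi> E)"
    proof (cases "comp l \<in> D")
      case True
      obtain \<phi> where \<phi>: "\<not> csat \<phi> D" "\<And>E. E \<in> F \<Longrightarrow> E \<noteq> D \<Longrightarrow> csat \<phi> E"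
        using MU_critical[OF assms(1)] D by blast
      then have "lit_true \<phi> l" using True unfolding csat_def by (metis lit_true_comp)
      then show ?thesis using \<phi> by blast
    next
      case False
      then obtain \<phi> where \<phi>: "csat \<phi> (insert l D)" "\<And>E. E \<in> F \<Longrightarrow> E \<noteq> D \<Longrightarrow> csat \<phi> E"
        using assms(2,3) D unfolding saturated_def satisfiable_csat by (metis (no_types, lifting) DiffI insert_iff mem_Collect_eq singletonD)
      then have "\<not> csat \<phi> D" using MU_unsat[OF assms(1)] by blast
      moreover from this have "lit_true \<phi> l" using \<phi>(1) by (simp add: csat_def)
      ultimately show ?thesis using \<phi>(2) by blast
    qed
    then obtain \<phi> where \<phi>: "lit_true \<phi> l" "\<not> csat \<phi> D" "\<forall>E\<in>F. E \<noteq> D \<longrightarrow> csat \<phi> E" by blast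
    have "csat \<phi> (?f E)" if "E \<in> ?A" "E \<noteq> D" for E
    proof -
      have "csat \<phi> E" using \<phi>(3) that by blast
      then obtain e where "e \<in> E" "lit_true \<phi> e" unfolding csat_def by blast
      then show ?thesis using \<phi>(1) unfolding csat_def by (intro bexI[of _ e]) auto
    qed
    moreover have "\<not> csat \<phi> (?f D)" using \<phi>(2) by (auto simp: csat_def)
    ultimately show ?thesis by blast
  qed
  show "assign_lit l F \<in> MU" "inj_on ?f ?A"
    using MU_imageI[OF fin cl unsat crit] unfolding assign_lit_def by blast+
qed

section \<open>Variables of minimal degree\<close>

definition vdeg :: "'v cls \<Rightarrow> 'v \<Rightarrow> nat" where
  "vdeg F v = ldeg F (Pos v) + ldeg F (Neg v)"

lemma vdeg_var_lit: "vdeg F (var_lit x) = ldeg F x + ldeg F (comp x)"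
  by (cases x) (auto simp: vdeg_def)

text \<open>A variable occurring only in clauses with \<open>l\<close> would have smaller degree than the variable of
  \<open>l\<close>, since the complement of \<open>l\<close> occurs as well.\<close>

lemma min_vdeg_var_assign_lit:
  assumes "F \<in> MU" "var_lit l \<in> var F"
    and min: "\<And>w. w \<in> var F \<Longrightarrow> vdeg F (var_lit l) \<le> vdeg F w"
  shows "var (assign_lit l F) = var F - {var_lit l}"
proof
  let ?G = "assign_lit l F"
  have fin: "finite F" using MU_finite[OF assms(1)] .
  show "var F - {var_lit l} \<subseteq> var ?G"
  proof
    fix w assume w: "w \<in> var F - {var_lit l}"
    have "\<exists>D\<in>F. l \<notin> D \<and> w \<in> var_clause D"
    proof (rule ccontr)
      assume contra: "\<not> ?thesis"
      let ?P = "{D \<in> F. Pos w \<in> D}" and ?N = "{D \<in> F. Neg w \<in> D}"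
      have "?P \<union> ?N \<subseteq> {D \<in> F. l \<in> D}"
        using contra var_clause_iff[of "Pos w"] by auto
      moreover have "?P \<inter> ?N = {}" using MU_no_clash[OF assms(1), of _ "Pos w"] by auto
      then have "card (?P \<union> ?N) = vdeg F w"
        using fin by (simp add: vdeg_def ldeg_def card_Un_disjoint)
      ultimately have "vdeg F w \<le> ldeg F l"
        using fin card_mono[of "{D \<in> F. l \<in> D}" "?P \<union> ?N"] unfolding ldeg_def by simp
      moreover have "0 < ldeg F (comp l)" using MU_ldeg_pos[OF assms(1)] assms(2) by simp
      ultimately show False using vdeg_var_lit[of F l] min[of w] w by simp
    qed
    then obtain D where D: "D \<in> F" "l \<notin> D" "w \<in> var_clause D" by blast
    then obtain x where x: "x \<in> D" "var_lit x = w" by (auto simp: var_clause_def)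
    then have "x \<in> D - {comp l}" using w by auto
    moreover have "D - {comp l} \<in> ?G" using D(1,2) by (auto simp: assign_lit_def)
    ultimately show "w \<in> var ?G" using x(2) unfolding var_iff by metis
  qed
  show "var ?G \<subseteq> var F - {var_lit l}"
  proof
    fix w assume "w \<in> var ?G"
    then obtain D x where "D \<in> F" "l \<notin> D" "x \<in> D" "x \<noteq> comp l" "var_lit x = w"
      by (auto simp: assign_lit_def var_iff)
    then show "w \<in> var F - {var_lit l}" using var_lit_eq_iff[of x l] by (auto simp: var_iff)
  qed
qed

text \<open>Making \<open>l\<close> true removes \<open>ldeg F l\<close> clauses and, by minimality
  of the degree, just one variable. The result is minimally unsatisfiable, so its deficiency is
  positive, which bounds the degree.\<close>

lemma saturated_min_vdeg:
  assumes "F \<in> MU" "saturated F" "var_lit l \<in> var F"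
    and min: "\<And>w. w \<in> var F \<Longrightarrow> vdeg F (var_lit l) \<le> vdeg F w"
  shows "deficiency (assign_lit l F) = deficiency F - int (ldeg F l) + 1"
    and "int (ldeg F l) \<le> deficiency F"
proof -
  let ?G = "assign_lit l F"
  have fin: "finite F" using MU_finite[OF assms(1)] .
  have "card (var F) = Suc (card (var ?G))"
    using min_vdeg_var_assign_lit[OF assms(1,3) min] assms(3) MU_finite_var[OF assms(1)]
    by (metis card_Suc_Diff1)
  moreover have "card ?G = card {D \<in> F. l \<notin> D}"
    using saturated_assign_lit(2)[OF assms(1-3)] unfolding assign_lit_def by (rule card_image)
  moreover have "card F = card {D \<in> F. l \<in> D} + card {D \<in> F. l \<notin> D}"
  proof -
    have "F = {D \<in> F. l \<in> D} \<union> {D \<in> F. l \<notin> D}" by blast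
    then show ?thesis using fin card_Un_disjoint[of "{D \<in> F. l \<in> D}" "{D \<in> F. l \<notin> D}"] by auto
  qed
  ultimately show *: "deficiency ?G = deficiency F - int (ldeg F l) + 1"
    by (simp add: deficiency_def c_cls_def n_vars_def ldeg_def)
  have "0 < deficiency ?G"
    using MU_deficiency_pos[OF saturated_assign_lit(1)[OF assms(1-3)]]
    by (simp add: deficiency_def c_cls_def n_vars_def)
  with * show "int (ldeg F l) \<le> deficiency F" by simp
qed

lemma ex_min_vdeg:
  assumes "F \<in> MU" "var F \<noteq> {}"
  obtains v where "v \<in> var F" "\<And>w. w \<in> var F \<Longrightarrow> vdeg F v \<le> vdeg F w"
  using assms MU_finite_var[OF assms(1)] arg_min_if_finite[of "var F" "vdeg F"]
  by (metis linorder_not_le)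

section \<open>Deficiency one\<close>

text \<open>A variable of minimal degree in a saturation occurs at most once in each sign there;
  saturating never lowers degrees, so the bound holds in \<open>M\<close>.\<close>

lemma MU1_ex_occurs_once:
  assumes "M \<in> MU" "deficiency M = 1" "var M \<noteq> {}"
  obtains u X Y where "occurs_once M u X" "occurs_once M (comp u) Y"
proof -
  obtain G where G: "G \<in> MU" "saturated G" "card G = card M" "var G = var M"
    "\<And>x. ldeg M x \<le> ldeg G x"
    using MU_saturation[OF assms(1)] by blast
  obtain v where v: "v \<in> var G" "\<And>w. w \<in> var G \<Longrightarrow> vdeg G v \<le> vdeg G w"
    using ex_min_vdeg[OF G(1)] assms(3) G(4) by metis
  have "deficiency G = 1" using assms(2) G(3,4) by (simp add: deficiency_def c_cls_def n_vars_def)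
  then have "ldeg M x = 1" if "var_lit x = v" for x
    using saturated_min_vdeg(2)[OF G(1,2), of x] MU_ldeg_pos[OF assms(1), of x] v G(4) G(5)[of x] that
    by simp
  from this[of "Pos v"] this[of "Neg v"] that[of "Pos v"] show ?thesis
    unfolding ldeg_eq_1_iff by auto
qed

lemma DP_one_one:
  assumes "M \<in> MU" "occurs_once M u X" "occurs_once M (comp u) Y"
  shows "DP (var_lit u) M = insert (X - {u} \<union> (Y - {comp u})) (M - {X, Y})"
proof -
  note X = occurs_onceD[OF assms(2)] and Y = occurs_onceD[OF assms(3)]
  have "X \<noteq> Y" using MU_no_clash[OF assms(1) X(1,2)] Y(2) by blast
  then have "M - {X} = insert Y (M - {X, Y})" using Y(1) by blast
  moreover have "subst_neg u X ` (M - {X, Y}) = M - {X, Y}"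
    using Y(3) by (auto simp: subst_neg_def image_iff)
  ultimately show ?thesis
    using Y(2) unfolding DP_eq_subst_neg[OF assms(1,2)] by (auto simp: subst_neg_def Un_commute)
qed

text \<open>Induction by reducing a variable that occurs once in each sign. If \<open>X\<close> and
  \<open>Y\<close> are its two clauses, they clash only there by \<open>occurs_once_clash\<close>;
  otherwise their clashes avoid this variable and persist when a parent is replaced by the
  resolvent.\<close>

lemma MU1_clash_unique:
  assumes "M \<in> MU" "deficiency M = 1" "X \<in> M" "Y \<in> M"
    and "x \<in> X" "comp x \<in> Y" "y \<in> X" "comp y \<in> Y"
  shows "x = y"
  using assms
proof (induction "card M" arbitrary: M X Y rule: less_induct)
  case less
  note MU = less.prems(1)
  have "var M \<noteq> {}" using var_memI[OF less.prems(3,5)] by blast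
  then obtain u U1 U2 where u: "occurs_once M u U1" "occurs_once M (comp u) U2"
    using MU1_ex_occurs_once[OF less.prems(1,2)] by blast
  note U1 = occurs_onceD[OF u(1)] and U2 = occurs_onceD[OF u(2)]
  have XY: "X \<noteq> Y" using MU_no_clash[OF MU less.prems(4)] less.prems(5,6) by blast
  consider "X = U1" "Y = U2" | "X = U2" "Y = U1" | "\<not> (X \<in> {U1, U2} \<and> Y \<in> {U1, U2})"
    using XY by blast
  then show ?case
  proof cases
    case 1
    have "z = u" if "z \<in> X" "comp z \<in> Y" for z
      using occurs_once_clashD[OF MU u(1) less.prems(4) _ _ that(2)] that(1) U2(2) 1 by blast
    then show ?thesis using less.prems(5-8) by blast
  next
    case 2
    have "z = comp u" if "z \<in> X" "comp z \<in> Y" for z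
      using occurs_once_clashD[OF MU u(2) less.prems(4) _ _ that(2)] that(1) U1(2) 2 by simp
    then show ?thesis using less.prems(5-8) by blast
  next
    case 3
    let ?K = "U1 - {u} \<union> (U2 - {comp u})" and ?G = "DP (var_lit u) M"
    let ?h = "\<lambda>Z. if Z \<in> {U1, U2} then ?K else Z"
    have G: "?G = insert ?K (M - {U1, U2})" using DP_one_one[OF MU u] .
    have ne: "z \<noteq> u \<and> z \<noteq> comp u" if "z \<in> X" "comp z \<in> Y" for z
      using that 3 U1(3) U2(3) less.prems(3,4) comp_comp by (metis insertCI)
    have h: "?h X \<in> ?G" "?h Y \<in> ?G" using G less.prems(3,4) by auto
    have mem: "z \<in> ?h X" "comp z \<in> ?h Y" if "z \<in> X" "comp z \<in> Y" for z
      using that ne[OF that] by (auto simp: comp_eq_swap)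
    show ?thesis
      using less.hyps[OF DP_occurs_once(3)[OF MU u(1)] DP_occurs_once(1)[OF MU u(1)] _ h]
        DP_occurs_once(2)[OF MU u(1)] less.prems mem by presburger
  qed
qed

text \<open>The induction reduces a variable occurring once in each sign; the resolvent takes over the role
  of \<open>X\<close>, and the witnesses, which avoid it, survive the reverse step.\<close>

lemma MU1_concentrated:
  assumes "M \<in> MU" "deficiency M = 1" "X \<in> M"
    and "\<forall>u Y Z. occurs_once M u Y \<longrightarrow> occurs_once M (comp u) Z \<longrightarrow> u \<in> X \<or> comp u \<in> X"
  shows "(\<forall>v\<in>var M. \<exists>x Z. var_lit x = v \<and> occurs_once M x Z \<and> Z \<noteq> X) \<and>
    (var M \<noteq> {} \<longrightarrow> (\<exists>z. {z} \<in> M \<and> {z} \<noteq> X))"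
  using assms
proof (induction "card M" arbitrary: M X rule: less_induct)
  case less
  note MU = less.prems(1)
  show ?case
  proof (cases "var M = {}")
    case False
    then obtain u0 U1 U2 where u0: "occurs_once M u0 U1" "occurs_once M (comp u0) U2"
      using MU1_ex_occurs_once[OF less.prems(1,2)] by blast
    \<comment> \<open>The hypothesis places each variable occurring once in both signs into
      \<open>X\<close>, so \<open>X\<close> is one of the two parents.\<close>
    obtain u where "u \<in> X" "u = u0 \<or> u = comp u0" using less.prems(4) u0 by blast
    then obtain Y where u: "occurs_once M u X" "occurs_once M (comp u) Y"
      using u0 less.prems(3) unfolding occurs_once_def by (metis comp_comp)
    note X = occurs_onceD[OF u(1)] and Y = occurs_onceD[OF u(2)]
    have XY: "X \<noteq> Y" using MU_no_clash[OF MU X(1,2)] Y(2) by blast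
    let ?K = "X - {u} \<union> (Y - {comp u})" and ?G = "DP (var_lit u) M"
    have G: "?G = insert ?K (M - {X, Y})" using DP_one_one[OF MU u] .
    have vG: "var ?G = var M - {var_lit u}"
      using var_subst_neg[OF MU u(1)] DP_eq_subst_neg[OF MU u(1)] by simp
    have lift: "occurs_once M t Z \<and> Z \<noteq> X" if t: "occurs_once ?G t Z" "t \<notin> ?K" for t Z
    proof -
      have "var_lit t \<noteq> var_lit u" using occurs_once_var[OF t(1)] vG by blast
      then have "t \<noteq> u" "t \<noteq> comp u" by auto
      with t(2) have "t \<notin> X" "t \<notin> Y" by auto
      moreover have "Z \<in> ?G" "t \<in> Z" using occurs_onceD(1,2)[OF t(1)] .
      ultimately have "Z \<in> M - {X, Y}" using G t(2) by auto
      moreover have "D = Z" if "D \<in> M" "t \<in> D" for D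
        using that \<open>t \<notin> X\<close> \<open>t \<notin> Y\<close> t(1) G unfolding occurs_once_def by blast
      ultimately show ?thesis using \<open>t \<in> Z\<close> unfolding occurs_once_def by blast
    qed
    have "(\<forall>v\<in>var ?G. \<exists>x Z. var_lit x = v \<and> occurs_once ?G x Z \<and> Z \<noteq> ?K) \<and>
      (var ?G \<noteq> {} \<longrightarrow> (\<exists>z. {z} \<in> ?G \<and> {z} \<noteq> ?K))"
    proof (rule less.hyps)
      show "card ?G < card M" "?G \<in> MU" "deficiency ?G = 1"
        using DP_occurs_once[OF MU u(1)] less.prems(2) by simp_all
      show "?K \<in> ?G" using G by simp
      have "t \<in> ?K \<or> comp t \<in> ?K" if t: "occurs_once ?G t Z1" "occurs_once ?G (comp t) Z2" for t Z1 Z2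
      proof (rule ccontr)
        assume no: "\<not> ?thesis"
        then have "occurs_once M t Z1" "occurs_once M (comp t) Z2" using lift t by blast+
        then have X: "t \<in> X \<or> comp t \<in> X" using less.prems(4) by blast
        have "var_lit t \<noteq> var_lit u" using occurs_once_var[OF t(1)] vG by blast
        then have "t \<noteq> u" "comp t \<noteq> u" by auto
        then show False using X no by blast
      qed
      then show "\<forall>t Y Z. occurs_once ?G t Y \<longrightarrow> occurs_once ?G (comp t) Z \<longrightarrow> t \<in> ?K \<or> comp t \<in> ?K"
        by blast
    qed
    then have IH: "\<And>v. v \<in> var ?G \<Longrightarrow> \<exists>x Z. var_lit x = v \<and> occurs_once ?G x Z \<and> Z \<noteq> ?K"
      "var ?G \<noteq> {} \<Longrightarrow> \<exists>z. {z} \<in> ?G \<and> {z} \<noteq> ?K" by blast+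
    have "\<exists>x Z. var_lit x = v \<and> occurs_once M x Z \<and> Z \<noteq> X" if v: "v \<in> var M" for v
    proof (cases "v = var_lit u")
      case True
      then show ?thesis using u(2) XY var_lit_comp by metis
    next
      case False
      then obtain x Z where x: "var_lit x = v" "occurs_once ?G x Z" "Z \<noteq> ?K"
        using IH(1)[of v] v vG by blast
      have "?K \<in> ?G" using G by simp
      then have "x \<notin> ?K" using occurs_onceD(3)[OF x(2)] x(3) by metis
      then show ?thesis using lift[OF x(2)] x(1) by blast
    qed
    moreover have "\<exists>z. {z} \<in> M \<and> {z} \<noteq> X"
    proof (cases "var ?G = {}")
      \<comment> \<open>With no variable left the resolvent is empty, so the second parent is a unit
        clause.\<close>
      case True
      have "?K = {}" using True G by (auto simp: var_def var_clause_def)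
      then have "Y = {comp u}" using Y(2) by blast
      then show ?thesis using Y(1) XY by blast
    next
      case False
      then obtain z where "{z} \<in> ?G" "{z} \<noteq> ?K" using IH(2) by metis
      then have "{z} \<in> M - {X, Y}" using G by simp
      then show ?thesis by blast
    qed
    ultimately show ?thesis by blast
  qed simp
qed

section \<open>Nonsingular clause-sets of deficiency two\<close>

lemma ldeg_insert:
  assumes "finite F" "C \<notin> F"
  shows "ldeg (insert C F) x = ldeg F x + of_bool (x \<in> C)"
proof (cases "x \<in> C")
  case True
  then have "{D \<in> insert C F. x \<in> D} = insert C {D \<in> F. x \<in> D}" by blast
  then show ?thesis using assms True by (simp add: ldeg_def)
next
  case False
  then have "{D \<in> insert C F. x \<in> D} = {D \<in> F. x \<in> D}" by blast
  then show ?thesis using False by (simp add: ldeg_def)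
qed

text \<open>The degree before splitting: the four clauses are counted separately, because clauses
  from opposite sides may coincide once the split variable is removed.\<close>

definition ldeg4 :: "'v clause \<Rightarrow> 'v clause \<Rightarrow> 'v clause \<Rightarrow> 'v clause \<Rightarrow> 'v cls \<Rightarrow> 'v lit \<Rightarrow> nat" where
  "ldeg4 A B D E R x =
     ldeg R x + of_bool (x \<in> A) + of_bool (x \<in> B) + of_bool (x \<in> D) + of_bool (x \<in> E)"

text \<open>The situation obtained by splitting a saturated nonsingular clause-set of deficiency two on
  a variable occurring in exactly four clauses: \<open>A\<close>, \<open>B\<close> come from the clauses with the positive
  and \<open>D\<close>, \<open>E\<close> from the clauses with the negative literal.\<close>

definition split_pair :: "'v clause \<Rightarrow> 'v clause \<Rightarrow> 'v clause \<Rightarrow> 'v clause \<Rightarrow> 'v cls \<Rightarrow> bool" where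
  "split_pair A B D E R \<longleftrightarrow>
     insert A (insert B R) \<in> MU \<and> insert D (insert E R) \<in> MU \<and>
     deficiency (insert A (insert B R)) = 1 \<and> deficiency (insert D (insert E R)) = 1 \<and>
     A \<notin> R \<and> B \<notin> R \<and> A \<noteq> B \<and> D \<notin> R \<and> E \<notin> R \<and> D \<noteq> E \<and>
     var (insert D (insert E R)) = var (insert A (insert B R)) \<and>
     (\<forall>x. var_lit x \<in> var (insert A (insert B R)) \<longrightarrow> 2 \<le> ldeg4 A B D E R x)"

lemma ldeg4_swap: "ldeg4 D E A B R = ldeg4 A B D E R"
  by (auto simp: ldeg4_def)

lemma ldeg4_swap_left: "ldeg4 B A D E R = ldeg4 A B D E R"
  by (auto simp: ldeg4_def)

lemma split_pair_swap: "split_pair A B D E R \<Longrightarrow> split_pair D E A B R"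
  unfolding split_pair_def ldeg4_swap[of D E] by auto

lemma split_pair_swap_left: "split_pair A B D E R \<Longrightarrow> split_pair B A D E R"
  unfolding split_pair_def ldeg4_swap_left[of A B] insert_commute[of A B] by blast

lemma MU_unit_occurs:
  assumes "F \<in> MU" "{z} \<in> F" "C \<in> F" "z \<in> C"
  shows "C = {z}"
proof (rule ccontr)
  assume "C \<noteq> {z}"
  obtain \<phi> where "\<not> csat \<phi> C" "\<And>E. E \<in> F \<Longrightarrow> E \<noteq> C \<Longrightarrow> csat \<phi> E"
    using MU_critical[OF assms(1,3)] by blast
  then have "csat \<phi> {z}" using assms(2) \<open>C \<noteq> {z}\<close> by blast
  then show False using \<open>\<not> csat \<phi> C\<close> assms(4) by (auto simp: csat_def)
qed

lemma split_pair_ldeg: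
  assumes "split_pair A B D E R"
  shows "ldeg4 A B D E R x = ldeg (insert A (insert B R)) x + of_bool (x \<in> D) + of_bool (x \<in> E)"
proof -
  have "finite R" using assms MU_finite[of "insert A (insert B R)"] by (auto simp: split_pair_def)
  then show ?thesis using assms by (simp add: ldeg4_def ldeg_insert split_pair_def)
qed

text \<open>A single occurrence on the first side leaves the second one, required by the degree
  bound, to \<open>D\<close> or \<open>E\<close>.\<close>

lemma split_pair_occurs_once:
  assumes sp: "split_pair A B D E R" and x: "occurs_once (insert A (insert B R)) x Z"
  shows "x \<in> D \<or> x \<in> E"
    and "ldeg4 A B D E R x = 1 + of_bool (x \<in> D) + of_bool (x \<in> E)"
proof -
  let ?M = "insert A (insert B R)"
  have "ldeg ?M x = 1" using x ldeg_eq_1_iff by blast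
  then show *: "ldeg4 A B D E R x = 1 + of_bool (x \<in> D) + of_bool (x \<in> E)"
    using split_pair_ldeg[OF sp, of x] by simp
  have "2 \<le> ldeg4 A B D E R x" using sp occurs_once_var[OF x] by (simp add: split_pair_def)
  with * show "x \<in> D \<or> x \<in> E" by (auto simp: of_bool_def split: if_splits)
qed

text \<open>A variable occurring once in both signs on the first side has both literals in
  \<open>D\<close> and \<open>E\<close>, so these clash on it; by \<open>MU1_clash_unique\<close>
  there is only one such variable.\<close>

lemma split_pair_singular:
  assumes sp: "split_pair A B D E R"
  obtains t X Y where "t \<in> D" "comp t \<in> E"
    "occurs_once (insert A (insert B R)) t X" "occurs_once (insert A (insert B R)) (comp t) Y"
    "\<And>u Z Z'. occurs_once (insert A (insert B R)) u Z \<Longrightarrow>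
       occurs_once (insert A (insert B R)) (comp u) Z' \<Longrightarrow> u = t \<or> u = comp t"
proof -
  let ?M = "insert A (insert B R)" and ?N = "insert D (insert E R)"
  have M: "?M \<in> MU" "deficiency ?M = 1" and N: "?N \<in> MU" "deficiency ?N = 1" and "A \<noteq> B"
    using sp by (auto simp: split_pair_def)
  have mem: "D \<in> ?N" "E \<in> ?N" by simp_all
  have clash: "u \<in> D \<and> comp u \<in> E \<or> comp u \<in> D \<and> u \<in> E"
    if "occurs_once ?M u Z" "occurs_once ?M (comp u) Z'" for u Z Z'
    using split_pair_occurs_once(1)[OF sp that(1)] split_pair_occurs_once(1)[OF sp that(2)]
      MU_no_clash[OF N(1) mem(1), of u] MU_no_clash[OF N(1) mem(2), of u] by blast
  have "var ?M \<noteq> {}"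
  proof
    assume "var ?M = {}"
    then have "A = {}" "B = {}" by (auto simp: var_def var_clause_def)
    then show False using \<open>A \<noteq> B\<close> by blast
  qed
  then obtain u X Y where u: "occurs_once ?M u X" "occurs_once ?M (comp u) Y"
    using MU1_ex_occurs_once[OF M] by blast
  obtain t X Y where t: "t \<in> D" "comp t \<in> E" "occurs_once ?M t X" "occurs_once ?M (comp t) Y"
    using clash[OF u] u by (metis comp_comp)
  have "u = t \<or> u = comp t" if "occurs_once ?M u Z" "occurs_once ?M (comp u) Z'" for u Z Z'
    using clash[OF that] MU1_clash_unique[OF N mem _ _ t(1,2)] by (metis comp_comp)
  then show ?thesis using that[OF t] by blast
qed

text \<open>The clause of the unique literal \<open>t\<close> meets the hypothesis of
  \<open>MU1_concentrated\<close>. So each variable has a literal occurring once, which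
  \<open>D\<close> or \<open>E\<close> must contain, and there is a unit clause.\<close>

lemma split_pair_structure:
  assumes sp: "split_pair A B D E R"
  shows "(\<exists>z. A = {z}) \<or> (\<exists>z. B = {z})"
    and "var (insert A (insert B R)) \<subseteq> var_clause D \<union> var_clause E"
proof -
  let ?M = "insert A (insert B R)" and ?N = "insert D (insert E R)"
  have M: "?M \<in> MU" "deficiency ?M = 1" and N: "?N \<in> MU"
    using sp by (auto simp: split_pair_def)
  obtain t X Y where t: "t \<in> D" "comp t \<in> E" "occurs_once ?M t X" "occurs_once ?M (comp t) Y"
    and uniq: "\<And>u Z Z'. occurs_once ?M u Z \<Longrightarrow> occurs_once ?M (comp u) Z' \<Longrightarrow> u = t \<or> u = comp t"
    using split_pair_singular[OF sp] by blast
  have "\<forall>u Z Z'. occurs_once ?M u Z \<longrightarrow> occurs_once ?M (comp u) Z' \<longrightarrow> u \<in> X \<or> comp u \<in> X"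
    using uniq occurs_onceD(2)[OF t(3)] by (metis comp_comp)
  from MU1_concentrated[OF M occurs_onceD(1)[OF t(3)] this]
  have conc: "\<forall>v\<in>var ?M. \<exists>x Z. var_lit x = v \<and> occurs_once ?M x Z" "\<exists>z. {z} \<in> ?M"
    using occurs_once_var[OF t(3)] by blast+
  show "var ?M \<subseteq> var_clause D \<union> var_clause E"
  proof
    fix v assume "v \<in> var ?M"
    then obtain x Z where x: "var_lit x = v" "occurs_once ?M x Z" using conc(1) by blast
    then show "v \<in> var_clause D \<union> var_clause E"
      using split_pair_occurs_once(1)[OF sp x(2)] var_clause_iff[of x] by blast
  qed
  obtain z where z: "{z} \<in> ?M" using conc(2) by blast
  \<comment> \<open>A shared unit clause would force its literal into \<open>D\<close> or
    \<open>E\<close>, which would then equal that unit clause and lie in \<open>R\<close>.\<close>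
  have "{z} \<notin> R"
  proof
    assume R: "{z} \<in> R"
    have "occurs_once ?M z {z}"
      using MU_unit_occurs[OF M(1) z] z unfolding occurs_once_def by blast
    then have "z \<in> D \<or> z \<in> E" using split_pair_occurs_once(1)[OF sp] by blast
    then have "D = {z} \<or> E = {z}" using MU_unit_occurs[OF N, of z] R by blast
    then show False using R sp by (auto simp: split_pair_def)
  qed
  then show "(\<exists>z. A = {z}) \<or> (\<exists>z. B = {z})" using z by auto
qed

text \<open>Away from the variable of the unit clause \<open>D\<close>, concentrating at
  \<open>B\<close> yields a literal that occurs once outside \<open>B\<close>; its second occurrence
  must be in \<open>E\<close>. Recording membership in \<open>E\<close> and not in \<open>B\<close>
  allows combination with the mirrored statement.\<close>

lemma split_pair_half:
  assumes sp: "split_pair A B D E R" and D: "D = {d}"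
    and full: "var (insert A (insert B R)) \<subseteq> var_clause B"
    and p: "p \<in> var (insert A (insert B R))"
  shows "(\<forall>x. var_lit x = p \<longrightarrow> ldeg4 A B D E R x \<le> 2) \<or>
    (\<exists>x. var_lit x = p \<and> ldeg4 A B D E R x \<le> 2 \<and> x \<in> E \<and> x \<notin> B)"
proof -
  let ?M = "insert A (insert B R)" and ?N = "insert D (insert E R)"
  have M: "?M \<in> MU" "deficiency ?M = 1" and N: "?N \<in> MU"
    using sp by (auto simp: split_pair_def)
  obtain t X Y where t: "t \<in> D" "comp t \<in> E" "occurs_once ?M t X" "occurs_once ?M (comp t) Y"
    and uniq: "\<And>u Z Z'. occurs_once ?M u Z \<Longrightarrow> occurs_once ?M (comp u) Z' \<Longrightarrow> u = t \<or> u = comp t"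
    using split_pair_singular[OF sp] by blast
  have d: "d = t" using t(1) D by simp
  have tE: "t \<notin> E" using MU_no_clash[OF N, of E t] t(2) by blast
  show ?thesis
  proof (cases "p = var_lit t")
    case True
    have "ldeg4 A B D E R t \<le> 2" "ldeg4 A B D E R (comp t) \<le> 2"
      using split_pair_occurs_once(2)[OF sp t(3)] split_pair_occurs_once(2)[OF sp t(4)] tE D d
      by auto
    then show ?thesis using True var_lit_eq_iff by metis
  next
    case False
    have "t \<in> B \<or> comp t \<in> B"
      using full occurs_once_var[OF t(3)] var_clause_iff by blast
    then have "\<forall>u Z Z'. occurs_once ?M u Z \<longrightarrow> occurs_once ?M (comp u) Z' \<longrightarrow> u \<in> B \<or> comp u \<in> B"
      using uniq by (metis comp_comp)
    from MU1_concentrated[OF M _ this] p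
    obtain x Z where x: "var_lit x = p" "occurs_once ?M x Z" "Z \<noteq> B" by blast
    have "x \<notin> B" using occurs_onceD(3)[OF x(2), of B] x(3) by blast
    moreover have "x \<notin> D" using x(1) False D d by auto
    moreover from this have "x \<in> E" using split_pair_occurs_once(1)[OF sp x(2)] by blast
    ultimately show ?thesis using split_pair_occurs_once(2)[OF sp x(2)] x(1) by auto
  qed
qed

lemma split_pair_full:
  assumes sp: "split_pair A B D E R" and D: "D = {d}"
  shows "var (insert A (insert B R)) \<subseteq> var_clause E"
proof -
  obtain t where t: "t \<in> D" "comp t \<in> E" using split_pair_singular[OF sp] by metis
  then have "var_clause D \<subseteq> var_clause E" using D by (auto simp: var_clause_def image_iff)
      (metis var_lit_comp)
  then show ?thesis using split_pair_structure(2)[OF sp] by blast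
qed

text \<open>The two versions of \<open>split_pair_half\<close> give a literal in \<open>E\<close>
  but not in \<open>B\<close> and one in \<open>B\<close> but not in \<open>E\<close>; over the same
  variable these are complementary, so both signs are bounded.\<close>

lemma split_pair_units:
  assumes sp: "split_pair A B D E R" and units: "A = {a}" "D = {d}"
    and x: "var_lit x \<in> var (insert A (insert B R))"
  shows "ldeg4 A B D E R x \<le> 2"
proof -
  note sp' = split_pair_swap[OF sp]
  have V: "var (insert D (insert E R)) = var (insert A (insert B R))"
    using sp by (simp add: split_pair_def)
  have B: "var (insert A (insert B R)) \<subseteq> var_clause B"
    using split_pair_full[OF sp' units(1)] V by simp
  have E: "var (insert D (insert E R)) \<subseteq> var_clause E"
    using split_pair_full[OF sp units(2)] V by simp
  show ?thesis
    using split_pair_half[OF sp units(2) B x] split_pair_half[OF sp' units(1) E, of "var_lit x"] x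
    unfolding V ldeg4_swap[of D E A B] by (metis var_lit_eq_iff)
qed

lemma split_pair_ldeg4_le:
  assumes sp: "split_pair A B D E R" and x: "var_lit x \<in> var (insert A (insert B R))"
  shows "ldeg4 A B D E R x \<le> 2"
proof -
  have wlog: "ldeg4 A B D E R x \<le> 2"
    if sp: "split_pair A B D E R" and A: "A = {a}" and x: "var_lit x \<in> var (insert A (insert B R))"
    for A B a
  proof -
    note sp' = split_pair_swap[OF sp]
    consider d where "D = {d}" | d where "E = {d}" using split_pair_structure(1)[OF sp'] by blast
    then show ?thesis
    proof cases
      case 1
      then show ?thesis using split_pair_units[OF sp A _ x] by blast
    next
      case 2
      have "split_pair A B E D R" using split_pair_swap[OF split_pair_swap_left[OF sp']] .
      then have "ldeg4 A B E D R x \<le> 2" using split_pair_units[OF _ A 2 x] by blast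
      then show ?thesis by (simp add: ldeg4_def)
    qed
  qed
  consider a where "A = {a}" | a where "B = {a}" using split_pair_structure(1)[OF sp] by blast
  then show ?thesis
  proof cases
    case 1
    then show ?thesis using wlog[OF sp _ x] by blast
  next
    case 2
    then show ?thesis
      using wlog[OF split_pair_swap_left[OF sp] 2] x
      by (simp add: ldeg4_swap_left insert_commute)
  qed
qed

text \<open>A variable of minimal degree occurs exactly twice in each sign. Splitting on it gives
  deficiency \<open>2 - 2 + 1 = 1\<close> on both sides, hence a \<open>split_pair\<close>, which
  bounds the degrees of all other literals.\<close>

lemma saturated_MU2_ldeg:
  assumes "F \<in> MU" "saturated F" "deficiency F = 2"
    and ge2: "\<And>x. var_lit x \<in> var F \<Longrightarrow> 2 \<le> ldeg F x"
    and x: "var_lit x \<in> var F"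
  shows "ldeg F x = 2"
proof -
  have "var F \<noteq> {}" using x by blast
  then obtain w where w: "w \<in> var F" and min: "\<And>u. u \<in> var F \<Longrightarrow> vdeg F w \<le> vdeg F u"
    using ex_min_vdeg[OF assms(1)] by metis
  have deg2: "ldeg F l = 2" if "var_lit l = w" for l
    using saturated_min_vdeg(2)[OF assms(1,2), of l] ge2[of l] that w min assms(3) by simp
  show ?thesis
  proof (cases "var_lit x = w")
    case True
    then show ?thesis using deg2 by blast
  next
    case False
    let ?p = "Pos w" and ?n = "Neg w"
    define R where "R = {C \<in> F. ?p \<notin> C \<and> ?n \<notin> C}"
    obtain A B where AB: "{C \<in> F. ?p \<in> C} = {A, B}" "A \<noteq> B"
      using deg2[of ?p] unfolding ldeg_def card_2_iff by auto
    obtain D E where DE: "{C \<in> F. ?n \<in> C} = {D, E}" "D \<noteq> E"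
      using deg2[of ?n] unfolding ldeg_def card_2_iff by auto
    have mem: "A \<in> F" "B \<in> F" "D \<in> F" "E \<in> F" "?p \<in> A" "?p \<in> B" "?n \<in> D" "?n \<in> E"
      using AB DE by blast+
    have nmem: "?n \<notin> A" "?n \<notin> B" "?p \<notin> D" "?p \<notin> E"
      using mem MU_no_clash[OF assms(1), of _ ?p] MU_no_clash[OF assms(1), of _ ?n] by auto
    have "{C \<in> F. ?n \<notin> C} = insert A (insert B R)"
      using AB(1) mem nmem unfolding R_def by blast
    moreover have R_id: "(\<lambda>C. C - {l}) ` R = R" if "l = ?p \<or> l = ?n" for l
    proof -
      have "(\<lambda>C. C - {l}) ` R = (\<lambda>C. C) ` R"
        using that by (intro image_cong) (auto simp: R_def)
      then show ?thesis by simp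
    qed
    ultimately have M: "assign_lit ?n F = insert (A - {?p}) (insert (B - {?p}) R)"
      and Minj: "inj_on (\<lambda>C. C - {?p}) (insert A (insert B R))"
      using saturated_assign_lit(2)[OF assms(1,2), of ?n] w by (simp_all add: assign_lit_def)
    have "{C \<in> F. ?p \<notin> C} = insert D (insert E R)"
      using DE(1) mem nmem unfolding R_def by blast
    then have N: "assign_lit ?p F = insert (D - {?n}) (insert (E - {?n}) R)"
      and Ninj: "inj_on (\<lambda>C. C - {?n}) (insert D (insert E R))"
      using saturated_assign_lit(2)[OF assms(1,2), of ?p] w R_id by (simp_all add: assign_lit_def)
    have notR: "A \<notin> R" "B \<notin> R" "D \<notin> R" "E \<notin> R" using mem by (auto simp: R_def)
    have F: "F = insert A (insert B (insert D (insert E R)))"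
      using AB(1) DE(1) mem unfolding R_def by blast
    have finR: "finite R" using MU_finite[OF assms(1)] by (simp add: R_def)
    have ldeg4: "ldeg4 (A - {?p}) (B - {?p}) (D - {?n}) (E - {?n}) R y = ldeg F y"
      if "var_lit y \<noteq> w" for y
    proof -
      have "y \<noteq> ?p" "y \<noteq> ?n" using that by auto
      moreover have "A \<noteq> D" "A \<noteq> E" "B \<noteq> D" "B \<noteq> E" using mem nmem by blast+
      then have "ldeg F y = ldeg4 A B D E R y"
        unfolding F using finR notR AB(2) DE(2) by (simp add: ldeg_insert ldeg4_def)
      ultimately show ?thesis by (simp add: ldeg4_def)
    qed
    have v: "var (assign_lit l F) = var F - {w}" "deficiency (assign_lit l F) = 1"
      "assign_lit l F \<in> MU" if "var_lit l = w" for l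
      using min_vdeg_var_assign_lit[OF assms(1), of l] saturated_min_vdeg(1)[OF assms(1,2), of l]
        saturated_assign_lit(1)[OF assms(1,2), of l] w min that deg2[OF that] assms(3) by simp_all
    \<comment> \<open>Removal of the split literal is injective on the remaining clauses and fixes
      \<open>R\<close>, so no shortened clause falls into \<open>R\<close>.\<close>
    have img: "C - {?p} \<notin> R" if "C \<in> {A, B}" for C
      using inj_on_image_mem_iff[OF Minj, of C R] R_id[of ?p] that notR by auto
    have img': "C - {?n} \<notin> R" if "C \<in> {D, E}" for C
      using inj_on_image_mem_iff[OF Ninj, of C R] R_id[of ?n] that notR by auto
    have ne: "A - {?p} \<noteq> B - {?p}" "D - {?n} \<noteq> E - {?n}"
      using inj_on_eq_iff[OF Minj, of A B] inj_on_eq_iff[OF Ninj, of D E] AB(2) DE(2) by auto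
    have "split_pair (A - {?p}) (B - {?p}) (D - {?n}) (E - {?n}) R"
      unfolding split_pair_def M[symmetric] N[symmetric]
      using v[of ?p] v[of ?n] img img' ne ge2 ldeg4 by auto
    from split_pair_ldeg4_le[OF this, of x] show ?thesis
      unfolding M[symmetric] using v(1)[of ?n] ldeg4 False x ge2[OF x] by simp
  qed
qed

lemma nonsingular_ldeg_ge_2:
  assumes "F \<in> MU" "nonsingular F" "var_lit x \<in> var F"
  shows "2 \<le> ldeg F x"
proof -
  have "ldeg F x \<noteq> 1"
    using assms(2) singular_iff[OF assms(1)] unfolding ldeg_eq_1_iff nonsingular_def by blast
  then show ?thesis using MU_ldeg_pos[OF assms(1,3)] by simp
qed

text \<open>If a literal could be added, saturating further would keep all degrees at least two,
  hence equal to two; but the degree of the added literal was already two before it grew.\<close>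

lemma nonsingular_MU2_saturated:
  assumes "F \<in> MU" "nonsingular F" "deficiency F = 2"
  shows "saturated F"
proof (rule ccontr)
  assume "\<not> saturated F"
  then obtain C l where C: "C \<in> F" "l \<notin> C" "comp l \<notin> C" and l: "var_lit l \<in> var F"
    and "\<not> satisfiable (insert (insert l C) (F - {C}))"
    unfolding saturated_def by blast
  then obtain G where G: "G \<in> MU" "card G = card F" "var G = var F"
    "\<And>x. ldeg F x \<le> ldeg G x" "ldeg F l < ldeg G l"
    using MU_insert_lit[OF assms(1)] by metis
  obtain H where H: "H \<in> MU" "saturated H" "card H = card G" "var H = var G"
    "\<And>x. ldeg G x \<le> ldeg H x"
    using MU_saturation[OF G(1)] by blast
  have "deficiency H = 2"
    using assms(3) G(2,3) H(3,4) by (simp add: deficiency_def c_cls_def n_vars_def)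
  moreover have "2 \<le> ldeg H x" if "var_lit x \<in> var H" for x
    using nonsingular_ldeg_ge_2[OF assms(1,2), of x] G(3) G(4)[of x] H(4) H(5)[of x] that
    by simp
  ultimately have "ldeg H l = 2" using saturated_MU2_ldeg[OF H(1,2)] l H(4) G(3) by simp
  then show False using nonsingular_ldeg_ge_2[OF assms(1,2) l] G(5) H(5)[of l] by simp
qed

text \<open>Equal degrees turn the inclusion into equality: \<open>y\<close> and \<open>z\<close>
  occur in the same clauses. Making \<open>y\<close> true removes every \<open>z\<close> but keeps a
  \<open>comp z\<close>, against \<open>MU_comp_occurs\<close>.\<close>

lemma nonsingular_MU2_no_dominated_lit:
  assumes F: "F \<in> MU" "nonsingular F" "deficiency F = 2"
    and y: "A \<in> F" "y \<in> A" and dom: "\<And>D. D \<in> F \<Longrightarrow> y \<in> D \<Longrightarrow> z \<in> D"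
  shows "z = y"
proof (rule ccontr)
  assume "z \<noteq> y"
  have sat: "saturated F" using nonsingular_MU2_saturated[OF F] .
  have zA: "z \<in> A" using dom y by blast
  have vars: "var_lit y \<in> var F" "var_lit z \<in> var F" using var_memI y(1,2) zA by metis+
  have "{D \<in> F. y \<in> D} = {D \<in> F. z \<in> D}"
  proof (rule card_subset_eq)
    show "finite {D \<in> F. z \<in> D}" using MU_finite[OF F(1)] by simp
    show "{D \<in> F. y \<in> D} \<subseteq> {D \<in> F. z \<in> D}" using dom by blast
    show "card {D \<in> F. y \<in> D} = card {D \<in> F. z \<in> D}"
      using saturated_MU2_ldeg[OF F(1) sat F(3) nonsingular_ldeg_ge_2[OF F(1,2)]] vars
      by (simp add: ldeg_def)
  qed
  then have eq: "\<And>D. D \<in> F \<Longrightarrow> z \<in> D \<Longrightarrow> y \<in> D" by blast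
  let ?G = "assign_lit y F"
  have G: "?G \<in> MU" using saturated_assign_lit(1)[OF F(1) sat vars(1)] .
  obtain D where D: "D \<in> F" "comp z \<in> D" using MU_comp_occurs[OF F(1) y(1) zA] .
  then have "y \<notin> D" using dom MU_no_clash[OF F(1), of D z] by blast
  then have "D - {comp y} \<in> ?G" "comp z \<in> D - {comp y}"
    using D \<open>z \<noteq> y\<close> by (auto simp: assign_lit_def)
  then obtain E where "E \<in> ?G" "z \<in> E" using MU_comp_occurs[OF G] by (metis comp_comp)
  then show False using eq by (auto simp: assign_lit_def)
qed

section \<open>Confluence up to isomorphism\<close>

lemma isomorphic_refl: "isomorphic F F"
  unfolding isomorphic_def by (rule exI[of _ id]) simp

lemma isomorphic_trans:
  assumes "isomorphic F G" "isomorphic G H"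
  shows "isomorphic F H"
proof -
  obtain f g where f: "bij f" "\<And>x. f (comp x) = comp (f x)" "(\<lambda>C. f ` C) ` F = G"
    and g: "bij g" "\<And>x. g (comp x) = comp (g x)" "(\<lambda>C. g ` C) ` G = H"
    using assms unfolding isomorphic_def by blast
  have "(\<lambda>C. (g \<circ> f) ` C) ` F = H"
    unfolding f(3)[symmetric] g(3)[symmetric] image_image by (simp add: image_comp)
  then show ?thesis
    unfolding isomorphic_def using bij_comp[OF f(1) g(1)] f(2) g(2) by (intro exI[of _ "g \<circ> f"]) simp
qed

definition swap_lits :: "'v lit \<Rightarrow> 'v lit \<Rightarrow> 'v lit \<Rightarrow> 'v lit" where
  "swap_lits x y z = (if z = x then y else if z = y then x
     else if z = comp x then comp y else if z = comp y then comp x else z)"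

lemma isomorphic_swap:
  assumes "var_lit x \<noteq> var_lit y" and "\<And>C. C \<in> F \<Longrightarrow> g C = swap_lits x y ` f C"
  shows "isomorphic (f ` F) (g ` F)"
proof -
  have ne: "x \<noteq> y" "x \<noteq> comp y" "y \<noteq> comp x" "comp x \<noteq> y" "comp y \<noteq> x" using assms(1) by auto
  have "swap_lits x y (swap_lits x y z) = z" for z using ne by (auto simp: swap_lits_def)
  then have "bij (swap_lits x y)" by (metis bijI')
  moreover have "swap_lits x y (comp z) = comp (swap_lits x y z)" for z
    using ne by (auto simp: swap_lits_def comp_eq_swap)
  moreover have "(\<lambda>C. swap_lits x y ` C) ` f ` F = g ` F"
    using assms(2) unfolding image_image by (intro image_cong) auto
  ultimately show ?thesis unfolding isomorphic_def by blast
qed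

section \<open>Normal forms of singular DP-reduction\<close>

lemma sDP_ex:
  assumes "F \<in> MU"
  obtains K where "K \<in> sDP F"
  using assms
proof (induction "card F" arbitrary: F thesis rule: less_induct)
  case less
  show ?case
  proof (cases "nonsingular F")
    case True
    then show ?thesis using less.prems unfolding sDP_def by blast
  next
    case False
    then obtain v where v: "singular F v" unfolding nonsingular_def by blast
    obtain K where K: "K \<in> sDP (DP v F)"
      using less.hyps DP_singular[OF less.prems(2) v] by metis
    have "sdp_step F (DP v F)" using v less.prems(2) unfolding sdp_step_def by blast
    then have "K \<in> sDP F"
      using K unfolding sDP_def by (auto intro: converse_rtranclp_into_rtranclp)
    then show ?thesis using less.prems(1) by blast
  qed
qed

lemma sDP_DP_subset:
  assumes "F \<in> MU" "singular F v"
  shows "sDP (DP v F) \<subseteq> sDP F"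
proof -
  have "sdp_step F (DP v F)" using assms unfolding sdp_step_def by blast
  then show ?thesis unfolding sDP_def by (auto intro: converse_rtranclp_into_rtranclp)
qed

lemma sDP_cases:
  assumes "G \<in> sDP F"
  shows "nonsingular F \<and> G = F \<or> (\<exists>v. singular F v \<and> G \<in> sDP (DP v F))"
proof -
  have G: "sdp_step\<^sup>*\<^sup>* F G" "G \<in> MU" "nonsingular G" using assms by (auto simp: sDP_def)
  from G(1) show ?thesis
  proof (cases rule: converse_rtranclpE)
    case base
    then show ?thesis using G(3) by blast
  next
    case (step H)
    then show ?thesis using G unfolding sdp_step_def sDP_def by auto
  qed
qed

lemma nonsingular_sDP: "nonsingular F \<Longrightarrow> G \<in> sDP F \<Longrightarrow> G = F"
  using sDP_cases unfolding nonsingular_def by blast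

text \<open>The hypothesis of \<open>DP_commute\<close> expressed for variables; a variable that
  occurs once in both signs may use either literal as its witness.\<close>

definition independent_singular :: "'v cls \<Rightarrow> 'v \<Rightarrow> 'v \<Rightarrow> bool" where
  "independent_singular F v w \<longleftrightarrow> v \<noteq> w \<and> (\<exists>x y C E. var_lit x = v \<and> var_lit y = w \<and>
     occurs_once F x C \<and> occurs_once F y E \<and> C \<noteq> E)"

lemma independent_singular_join:
  assumes "F \<in> MU" "independent_singular F v w"
  obtains K where "K \<in> sDP (DP v F)" "K \<in> sDP (DP w F)"
proof -
  obtain x y C E where xy: "v = var_lit x" "w = var_lit y" "var_lit x \<noteq> var_lit y"
    "occurs_once F x C" "occurs_once F y E" "C \<noteq> E"
    using assms(2) unfolding independent_singular_def by blast
  have MU: "DP v F \<in> MU" "DP w F \<in> MU" using DP_occurs_once(1)[OF assms(1)] xy by simp_all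
  have "singular (DP v F) w"
    using singular_iff[OF MU(1)] occurs_once_subst_neg[OF assms(1) xy(4-6,3)] xy(1,2) by blast
  moreover have "singular (DP w F) v"
    using singular_iff[OF MU(2)] occurs_once_subst_neg[OF assms(1) xy(5,4) xy(6,3)[symmetric]] xy(1,2)
    by blast
  moreover have "DP w (DP v F) = DP v (DP w F)"
    using DP_commute[OF assms(1) xy(4-6,3)] xy(1,2) by simp
  moreover obtain K where "K \<in> sDP (DP w (DP v F))"
    using sDP_ex DP_singular(1)[OF MU(1) \<open>singular (DP v F) w\<close>] by metis
  ultimately show ?thesis using that sDP_DP_subset[OF MU(1)] sDP_DP_subset[OF MU(2)] by (metis subsetD)
qed

text \<open>A literal of \<open>C\<close> is copied into at least two images, as
  \<open>comp x\<close> occurs at least twice. Any other remaining literal keeps its degree, and if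
  it occurred once in \<open>F\<close>, its clause would be the deleted \<open>C\<close>.\<close>

lemma nonsingular_DP:
  assumes "F \<in> MU" "occurs_once F x C" "\<And>D. \<not> occurs_once F (comp x) D"
    and only: "\<And>z A. occurs_once F z A \<Longrightarrow> A = C"
  shows "nonsingular (DP (var_lit x) F)"
proof (rule ccontr)
  let ?G = "DP (var_lit x) F"
  note C = occurs_onceD[OF assms(2)]
  have G: "?G = subst_neg x C ` (F - {C})" using DP_eq_subst_neg[OF assms(1,2)] .
  assume "\<not> nonsingular ?G"
  then obtain z A where z: "occurs_once ?G z A"
    using singular_iff[OF DP_occurs_once(1)[OF assms(1,2)]] unfolding nonsingular_def by blast
  then obtain D0 where D0: "D0 \<in> F - {C}" "A = subst_neg x C D0" "z \<in> subst_neg x C D0"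
    using G occurs_onceD(1,2)[OF z] by blast
  have zx: "z \<noteq> x" "z \<noteq> comp x"
    using subst_neg_no_var[OF assms(1,2) D0(1)] D0(3) by blast+
  have once: "D = D0" if "D \<in> F - {C}" "z \<in> subst_neg x C D" for D
  proof -
    have "subst_neg x C D = subst_neg x C D0"
      using occurs_onceD(3)[OF z, of "subst_neg x C D"] that G D0(2) by simp
    then show ?thesis using subst_neg_MU(2)[OF assms(1,2)] that(1) D0(1) by (meson inj_onD)
  qed
  show False
  proof (cases "z \<in> C")
    case True
    obtain D1 where D1: "D1 \<in> F - {C}" "comp x \<in> D1" using occurs_once_comp_occurs[OF assms(1,2)] .
    then obtain D2 where D2: "D2 \<in> F" "comp x \<in> D2" "D2 \<noteq> D1"
      using assms(3)[of D1] unfolding occurs_once_def by blast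
    then have "D2 \<in> F - {C}" using MU_no_clash[OF assms(1) C(1,2)] by blast
    moreover have "z \<in> subst_neg x C D" if "comp x \<in> D" for D
      using that True zx by (simp add: subst_neg_def)
    ultimately show False using once D1 D2(2,3) by metis
  next
    case False
    have iff: "z \<in> subst_neg x C D \<longleftrightarrow> z \<in> D" for D
      using False zx by (simp add: subst_neg_def)
    have "occurs_once F z D0"
      unfolding occurs_once_def using D0 once iff False by blast
    then show False using only D0(1) by blast
  qed
qed

text \<open>After reducing \<open>x\<close>, the literal \<open>y\<close> occurs only where a copy
  of \<open>C - {x}\<close> was inserted, so every literal of \<open>C - {x}\<close> dominates it;
  hence \<open>C = {x, y}\<close>.\<close>

lemma dependent_singular_isomorphic:
  assumes F: "F \<in> MU" "deficiency F = 2"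
    and x: "occurs_once F x C" "\<And>D. \<not> occurs_once F (comp x) D"
    and y: "occurs_once F y C" "\<And>D. \<not> occurs_once F (comp y) D"
    and ne: "var_lit x \<noteq> var_lit y"
    and only: "\<And>z A. occurs_once F z A \<Longrightarrow> A = C"
  shows "isomorphic (DP (var_lit x) F) (DP (var_lit y) F)"
proof -
  let ?G = "DP (var_lit x) F"
  have ne': "x \<noteq> y" "x \<noteq> comp y" "y \<noteq> comp x" "comp x \<noteq> y" "comp y \<noteq> x" using ne by auto
  have G: "?G = subst_neg x C ` (F - {C})" using DP_eq_subst_neg[OF F(1) x(1)] .
  have yC: "y \<in> C" and xC: "x \<in> C" using occurs_onceD(2) x(1) y(1) by metis+
  have ynot: "y \<notin> D" and xnot: "x \<notin> D" if "D \<in> F - {C}" for D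
    using occurs_onceD(3)[OF y(1)] occurs_onceD(3)[OF x(1)] that by blast+
  obtain D1 where D1: "D1 \<in> F - {C}" "comp x \<in> D1" using occurs_once_comp_occurs[OF F(1) x(1)] .
  have "z = y" if z: "z \<in> C - {x}" for z
  proof (rule nonsingular_MU2_no_dominated_lit)
    show "?G \<in> MU" "deficiency ?G = 2" using DP_occurs_once[OF F(1) x(1)] F(2) by simp_all
    show "nonsingular ?G" using nonsingular_DP[OF F(1) x only] .
    show "subst_neg x C D1 \<in> ?G" using G D1(1) by blast
    show "y \<in> subst_neg x C D1" using D1(2) yC ne' by (simp add: subst_neg_def)
    fix D' assume "D' \<in> ?G" "y \<in> D'"
    then obtain D where D: "D \<in> F - {C}" "D' = subst_neg x C D" "y \<in> subst_neg x C D"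
      using G by blast
    then have "comp x \<in> D" using ynot[OF D(1)] by (auto simp: subst_neg_def split: if_splits)
    then show "z \<in> D'" using z D(2) by (auto simp: subst_neg_def)
  qed
  then have C: "C = {x, y}" using xC yC by blast
  \<comment> \<open>One reduction replaces \<open>comp x\<close> by \<open>y\<close>, the other
    \<open>comp y\<close> by \<open>x\<close>; no clause contains both complements, so exchanging
    \<open>comp x\<close> with \<open>y\<close> links the results.\<close>
  have "isomorphic (subst_neg x C ` (F - {C})) (subst_neg y C ` (F - {C}))"
  proof (rule isomorphic_swap)
    show "var_lit (comp x) \<noteq> var_lit y" using ne by simp
    fix D assume D: "D \<in> F - {C}"
    have "comp y \<notin> D" if "comp x \<in> D"
      using occurs_once_clashD[OF F(1) x(1) _ that yC] D ne' by blast
    then show "subst_neg y C D = swap_lits (comp x) y ` subst_neg x C D"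
      using ynot[OF D] xnot[OF D] ne' unfolding subst_neg_def C
      by (auto simp: swap_lits_def image_iff)
  qed
  then show ?thesis using G DP_eq_subst_neg[OF F(1) y(1)] by simp
qed

theorem theorem74:
  fixes F :: "'v cls"
  assumes "F \<in> MU" and "deficiency F = 2"
  shows "\<forall>G\<in>sDP F. \<forall>H\<in>sDP F. isomorphic G H"
  using assms
proof (induction "card F" arbitrary: F rule: less_induct)
  case less
  note MU = less.prems(1)
  have IH: "isomorphic G H" if "singular F v" "G \<in> sDP (DP v F)" "H \<in> sDP (DP v F)" for v G H
    using less.hyps[of "DP v F"] DP_singular[OF MU that(1)] less.prems(2) that(2,3) by simp
  \<comment> \<open>A common normal form is compared with \<open>G\<close> and with \<open>H\<close>
    by the induction hypothesis for the two reducts.\<close>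
  have joinable: "isomorphic G H"
    if "singular F v" "singular F w" "independent_singular F v w"
      "G \<in> sDP (DP v F)" "H \<in> sDP (DP w F)" for v w G H
    using independent_singular_join[OF MU that(3)] IH that isomorphic_trans by metis
  have "isomorphic G H"
    if v: "singular F v" "G \<in> sDP (DP v F)" and w: "singular F w" "H \<in> sDP (DP w F)" for v w G H
  proof -
    consider "v = w" | "independent_singular F v w"
      | "v \<noteq> w" "\<not> independent_singular F v w" by blast
    then show ?thesis
    proof cases
      case 3
      obtain x C where x: "var_lit x = v" "occurs_once F x C" using v(1) singular_iff[OF MU] by blast
      have common: "E = C'" if "var_lit x' = v" "occurs_once F x' C'" "var_lit y = w" "occurs_once F y E"
        for x' y C' E
        using 3 that unfolding independent_singular_def by blast
      obtain y where y: "var_lit y = w" "occurs_once F y C"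
        using w(1) singular_iff[OF MU] common x by metis
      show ?thesis
      \<comment> \<open>As \<open>v\<close> and \<open>w\<close> share the clause \<open>C\<close>,
        a variable independent of \<open>v\<close> is independent of \<open>w\<close> too, and the
        two reductions are joined through it.\<close>
      proof (cases "\<exists>u. independent_singular F u v")
        case True
        then obtain u z x' A B where u: "u \<noteq> v" "var_lit z = u" "occurs_once F z A"
          "var_lit x' = v" "occurs_once F x' B" "A \<noteq> B"
          unfolding independent_singular_def by blast
        have "B = C" using common[OF u(4,5) y] by simp
        then have "independent_singular F u w"
          using u y 3(2) True unfolding independent_singular_def by (metis (full_types))
        moreover have "independent_singular F v u"
          using u unfolding independent_singular_def by metis
        moreover have "singular F u" using u singular_iff[OF MU] by blast
        moreover obtain K where "K \<in> sDP (DP u F)"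
          using sDP_ex DP_singular(1)[OF MU \<open>singular F u\<close>] by metis
        ultimately show ?thesis using joinable v w isomorphic_trans by metis
      next
        case False
        \<comment> \<open>The clause of a single \<open>comp x\<close> would also have to be
          \<open>C\<close>, which already contains \<open>x\<close>.\<close>
        have nx: "\<not> occurs_once F (comp x) D" for D
          using common[OF _ _ y, of "comp x" D] x occurs_onceD(1,2) MU_no_clash[OF MU]
          by (metis var_lit_comp)
        have ny: "\<not> occurs_once F (comp y) D" for D
          using common[OF x, of "comp y" D] y occurs_onceD(1,2) MU_no_clash[OF MU]
          by (metis var_lit_comp)
        have only: "A = C" if "occurs_once F z A" for z A
        proof (cases "var_lit z = v")
          case True
          then have "z = x \<or> z = comp x" using x(1) var_lit_eq_iff by metis
          then show ?thesis using that nx x(2) occurs_onceD by metis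
        next
          case z: False
          then show ?thesis using False that x unfolding independent_singular_def by blast
        qed
        have "nonsingular (DP v F)" "nonsingular (DP w F)"
          using nonsingular_DP[OF MU x(2) nx only] nonsingular_DP[OF MU y(2) ny only] x(1) y(1)
          by simp_all
        then have "G = DP v F" "H = DP w F" using nonsingular_sDP v(2) w(2) by blast+
        then show ?thesis
          using dependent_singular_isomorphic[OF MU less.prems(2) x(2) nx y(2) ny _ only] x(1) y(1) 3(1)
          by simp
      qed
    qed (use IH joinable v w in blast)+
  qed
  then show ?case
    using sDP_cases isomorphic_refl unfolding nonsingular_def by metis
qed

end
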